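(* For every family $(\alpha_k)$ as below, $\mathrm{3SAT}^{\mathrm C}\notin \mathrm{P}^*_{\mathrm{lis}}$ if and only if $\mathrm{3SAT}\notin\mathrm{P/poly}$.
   Context: $\mathbb B=\{T,F\}$. $\mathrm{3SAT}$ is the language of (standardly encoded) satisfiable 3CNF formulas; $\mathrm{P/poly}$ is the usual class of languages decided by polynomial-size circuit families. Let $v_1,v_2,\dots$ be propositional variables. For $k\in\mathbb N$ let $d(k)=\binom{2k}{1}+\binom{2k}{2}+\binom{2k}{3}$, and let $L_k$ be the set of sets $L$ of literals from $\{v_1,\neg v_1,\dots,v_k,\neg v_k\}$ with $1\le |L|\le 3$. Let $(\alpha_k)_{k\in\mathbb N}$ be bijections $\alpha_k:[1,d(k)]\to L_k$ such that (i) for all $i$ and $j\in[1,d(i)]$, $\alpha_{i+1}(j)=\alpha_i(j)$; and (ii) the map $\alpha(i)=\alpha_k(i)$ for the least $k$ with $i\le d(k)$ is polynomial-time computable. For $n\in\mathbb N$ let $k$ be such that $d(k)\le n<d(k+1)$ and define $\mathrm{3SAT}^{\mathrm C}_n:\mathbb B^n\to\mathbb B$ by $\mathrm{3SAT}^{\mathrm C}_n(b_1,\dots,b_n)=T$ iff $\bigwedge_{i\in[1,d(k)],\,b_i=T}\bigvee\alpha_k(i)$ is satisfiable; $\mathrm{3SAT}^{\mathrm C}=(\mathrm{3SAT}^{\mathrm C}_n)_n$. A primitive instruction is one of: a plain basic instruction $a$, a positive test instruction $+a$, a negative test instruction $-a$ (for a basic instruction $a$), a forward jump instruction $\#l$ ($l\in\mathbb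 N$), or the termination instruction $!$. An instruction sequence is a finite nonempty sequence $X=u_1;\dots;u_k$ of primitive instructions; its length is $|X|=k$. Basic instructions have the form $f.m$ where the focus $f$ is one of $\mathrm{in}{:}i$, $\mathrm{aux}{:}i$ ($i\ge 1$) or $\mathrm{out}$, each naming a Boolean register, and the method $m$ is one of $\mathrm{set}{:}T$, $\mathrm{set}{:}F$, $\mathrm{get}$. Executing $f.\mathrm{set}{:}b$ sets register $f$ to $b$ and yields reply $b$; executing $f.\mathrm{get}$ leaves the register unchanged and yields its content as reply. Execution of $X=u_1;\dots;u_k$: a counter starts at $1$. If the counter exceeds $k$, execution deadlocks. At position $i$: if $u_i=!$, execution terminates; if $u_i=\#l$, execution deadlocks if $l=0$ and otherwise the counter becomes $i+l$; if $u_i$ is $a$, $+a$ or $-a$, the basic instruction $a$ is executed yielding reply $r$, and the counter becomes $i+1$ for $u_i=a$; for $u_i=+a$ it becomes $i+1$ if $r=T$ and $i+2$ if $r=F$; for $u_i=-a$ it becomes $i+1$ if $r=F$ and $i+2$ if $r=T$. $\mathrm{IS}_{br}$ is the set of instruction sequences in which every basic instruction occurring belongs to $\{f.\mathrm{get}: f=\mathrm{in}{:}i \text{ or } f=\mathrm{aux}{:}i\}\cup\{f.\mathrm{set}{:}b: f=\mathrm{aux}{:}i \text{ or } f=\mathrm{out},\ b\in\mathbb B\}$. $X\in\mathrm{IS}_{br}$ computes $f:\mathbb B^n\to\mathbb B$ if for every $(b_1,\dots,b_n)\in\mathbb B^n$: when $X$ is executed with register $\mathrm{in}{:}j$ initialised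 to $b_j$ ($j\le n$) and all registers $\mathrm{aux}{:}i$ and $\mathrm{out}$ initialised to $F$, execution terminates without ever executing a basic instruction with focus $\mathrm{in}{:}j$ for $j>n$, and at termination register $\mathrm{out}$ contains $f(b_1,\dots,b_n)$. $\mathrm{P}^*_{\mathrm{lis}}$ is the class of Boolean function families $(f_n)_{n\in\mathbb N}$ ($f_n:\mathbb B^n\to\mathbb B$) for which there is a polynomial $h$ such that for every $n$ there is $X\in\mathrm{IS}_{br}$ computing $f_n$ with $|X|\le h(n)$. *)

theory Defs
  imports Main "HOL-Computational_Algebra.Polynomial"
begin

text \<open>The Booleans T, F are rendered as True, False.  Variables v_1, v_2, ...
  are identified with their (positive) indices.\<close>

datatype lit = Pos nat | Neg nat

fun lit_val :: "(nat \<Rightarrow> bool) \<Rightarrow> lit \<Rightarrow> bool" where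
  "lit_val \<sigma> (Pos v) = \<sigma> v"
| "lit_val \<sigma> (Neg v) = (\<not> \<sigma> v)"

definition dd :: "nat \<Rightarrow> nat" where
  "dd k = (2*k choose 1) + (2*k choose 2) + (2*k choose 3)"

definition lits :: "nat \<Rightarrow> lit set" where
  "lits k = {Pos i | i. 1 \<le> i \<and> i \<le> k} \<union> {Neg i | i. 1 \<le> i \<and> i \<le> k}"

definition Lk :: "nat \<Rightarrow> lit set set" where
  "Lk k = {L. L \<subseteq> lits k \<and> 1 \<le> card L \<and> card L \<le> 3}"

definition poly_bounded :: "(nat \<Rightarrow> nat) \<Rightarrow> real poly \<Rightarrow> bool" where
  "poly_bounded g h = (\<forall>n. real (g n) \<le> poly h (real n))"

fun bin :: "nat \<Rightarrow> bool list" where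
  "bin 0 = []"
| "bin n = bin (n div 2) @ [odd n]"

datatype sym = S0 | S1 | SNeg | SSep | SEnd

fun sym_bits :: "sym \<Rightarrow> bool list" where
  "sym_bits S0 = [False, False, True]"
| "sym_bits S1 = [False, True, False]"
| "sym_bits SNeg = [False, True, True]"
| "sym_bits SSep = [True, False, False]"
| "sym_bits SEnd = [True, False, True]"

fun enc_lit :: "lit \<Rightarrow> sym list" where
  "enc_lit (Pos v) = map (\<lambda>b. if b then S1 else S0) (bin v)"
| "enc_lit (Neg v) = SNeg # map (\<lambda>b. if b then S1 else S0) (bin v)"

definition enc_clause :: "lit list \<Rightarrow> sym list" where
  "enc_clause c = concat (map (\<lambda>l. enc_lit l @ [SSep]) c) @ [SEnd]"

definition to_bits :: "sym list \<Rightarrow> bool list" where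
  "to_bits s = concat (map sym_bits s)"

definition enc_formula :: "lit list list \<Rightarrow> bool list" where
  "enc_formula \<phi> = to_bits (concat (map enc_clause \<phi>))"

fun lit_var :: "lit \<Rightarrow> nat" where
  "lit_var (Pos v) = v"
| "lit_var (Neg v) = v"

definition is_3cnf :: "lit list list \<Rightarrow> bool" where
  "is_3cnf \<phi> = (\<forall>c\<in>set \<phi>. 1 \<le> length c \<and> length c \<le> 3 \<and> (\<forall>l\<in>set c. 1 \<le> lit_var l))"

definition cnf_sat :: "lit list list \<Rightarrow> bool" where
  "cnf_sat \<phi> = (\<exists>\<sigma>. \<forall>c\<in>set \<phi>. \<exists>l\<in>set c. lit_val \<sigma> l)"

definition ThreeSAT :: "bool list set" where
  "ThreeSAT = {w. \<exists>\<phi>. is_3cnf \<phi> \<and> cnf_sat \<phi> \<and> w = enc_formula \<phi>}"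

datatype gate = GInput nat | GConst bool | GNot nat | GAnd nat nat | GOr nat nat

fun gate_val :: "bool list \<Rightarrow> bool list \<Rightarrow> gate \<Rightarrow> bool" where
  "gate_val w vs (GInput j) = w ! j"
| "gate_val w vs (GConst b) = b"
| "gate_val w vs (GNot i) = (\<not> vs ! i)"
| "gate_val w vs (GAnd i j) = (vs ! i \<and> vs ! j)"
| "gate_val w vs (GOr i j) = (vs ! i \<or> vs ! j)"

definition eval_wires :: "bool list \<Rightarrow> gate list \<Rightarrow> bool list" where
  "eval_wires w C = foldl (\<lambda>vs g. vs @ [gate_val w vs g]) [] C"

fun gate_wf :: "nat \<Rightarrow> nat \<Rightarrow> gate \<Rightarrow> bool" where
  "gate_wf n p (GInput j) = (j < n)"
| "gate_wf n p (GConst b) = True"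
| "gate_wf n p (GNot i) = (i < p)"
| "gate_wf n p (GAnd i j) = (i < p \<and> j < p)"
| "gate_wf n p (GOr i j) = (i < p \<and> j < p)"

definition circuit_wf :: "nat \<Rightarrow> gate list \<Rightarrow> bool" where
  "circuit_wf n C = (C \<noteq> [] \<and> (\<forall>p<length C. gate_wf n p (C ! p)))"

definition circuit_out :: "gate list \<Rightarrow> bool list \<Rightarrow> bool" where
  "circuit_out C w = last (eval_wires w C)"

definition P_poly :: "bool list set set" where
  "P_poly = {L. \<exists>h :: real poly. \<forall>n. \<exists>C. circuit_wf n C \<and>
      real (length C) \<le> poly h (real n) \<and>
      (\<forall>w. length w = n \<longrightarrow> (circuit_out C w \<longleftrightarrow> w \<in> L))}"

text \<open>A deterministic one-tape Turing machine (Q, S, delta): states 0..<Q, start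
  state 0, halting state 1; tape symbols 0..<S with 0 the blank, 1 encoding the
  bit False and 2 the bit True; delta q a = (q', a', move), move in {-1,0,1}.\<close>
type_synonym tm = "nat \<times> nat \<times> (nat \<Rightarrow> nat \<Rightarrow> nat \<times> nat \<times> int)"

definition tm_wf :: "tm \<Rightarrow> bool" where
  "tm_wf M = (case M of (Q, S, \<delta>) \<Rightarrow> 2 \<le> Q \<and> 3 \<le> S \<and>
     (\<forall>q<Q. \<forall>a<S. case \<delta> q a of (q', a', m) \<Rightarrow> q' < Q \<and> a' < S \<and> m \<in> {-1, 0, 1}))"

type_synonym tm_config = "nat \<times> (int \<Rightarrow> nat) \<times> int"

definition tm_step :: "tm \<Rightarrow> tm_config \<Rightarrow> tm_config" where
  "tm_step M c = (case M of (Q, S, \<delta>) \<Rightarrow> case c of (q, tp, h) \<Rightarrow>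
     if q = 1 then c else (case \<delta> q (tp h) of (q', a', m) \<Rightarrow> (q', tp(h := a'), h + m)))"

definition bit_sym :: "bool \<Rightarrow> nat" where
  "bit_sym b = (if b then 2 else 1)"

definition tm_init :: "bool list \<Rightarrow> tm_config" where
  "tm_init w = (0, (\<lambda>j. if 0 \<le> j \<and> j < int (length w) then bit_sym (w ! nat j) else 0), 0)"

definition tape_holds :: "(int \<Rightarrow> nat) \<Rightarrow> bool list \<Rightarrow> bool" where
  "tape_holds tp v = ((\<forall>j<length v. tp (int j) = bit_sym (v ! j)) \<and> tp (int (length v)) = 0)"

definition tm_computes_in :: "tm \<Rightarrow> bool list set \<Rightarrow> (bool list \<Rightarrow> bool list \<Rightarrow> bool)
    \<Rightarrow> real poly \<Rightarrow> bool" where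
  "tm_computes_in M D R h = (\<forall>w\<in>D. \<exists>t v. real t \<le> poly h (real (length w)) \<and>
      (case (tm_step M ^^ t) (tm_init w) of (q, tp, pos) \<Rightarrow> q = 1 \<and> tape_holds tp v) \<and> R w v)"

definition ptime_computable :: "bool list set \<Rightarrow> (bool list \<Rightarrow> bool list \<Rightarrow> bool) \<Rightarrow> bool" where
  "ptime_computable D R = (\<exists>M h. tm_wf M \<and> tm_computes_in M D R h)"

definition alpha_lim :: "(nat \<Rightarrow> nat \<Rightarrow> lit set) \<Rightarrow> nat \<Rightarrow> lit set" where
  "alpha_lim \<alpha> i = \<alpha> (LEAST k. i \<le> dd k) i"

definition alpha_ptime :: "(nat \<Rightarrow> nat \<Rightarrow> lit set) \<Rightarrow> bool" where
  "alpha_ptime \<alpha> = ptime_computable {bin i | i. 1 \<le> i}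
     (\<lambda>w v. \<exists>i c. 1 \<le> i \<and> w = bin i \<and> set c = alpha_lim \<alpha> i \<and> v = to_bits (enc_clause c))"

definition alpha_family :: "(nat \<Rightarrow> nat \<Rightarrow> lit set) \<Rightarrow> bool" where
  "alpha_family \<alpha> = ((\<forall>k. bij_betw (\<alpha> k) {1..dd k} (Lk k)) \<and>
     (\<forall>i. \<forall>j\<in>{1..dd i}. \<alpha> (Suc i) j = \<alpha> i j) \<and>
     alpha_ptime \<alpha>)"

definition kk :: "nat \<Rightarrow> nat" where
  "kk n = (THE k. dd k \<le> n \<and> n < dd (Suc k))"

text \<open>Boolean function families (f_n) are represented as f :: nat => bool list => bool;
  f n is meant on lists of length n, where b_j is the list element at index j-1.\<close>
definition ThreeSATC :: "(nat \<Rightarrow> nat \<Rightarrow> lit set) \<Rightarrow> nat \<Rightarrow> bool list \<Rightarrow> bool" where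
  "ThreeSATC \<alpha> n b = (\<exists>\<sigma>. \<forall>i\<in>{1..dd (kk n)}. b ! (i - 1) \<longrightarrow>
       (\<exists>l\<in>\<alpha> (kk n) i. lit_val \<sigma> l))"

datatype focus = FIn nat | FAux nat | FOut
datatype meth = MSet bool | MGet
datatype basic = BI focus meth
datatype prim = Plain basic | PTest basic | NTest basic | Jump nat | Halt

fun exec_basic :: "basic \<Rightarrow> (focus \<Rightarrow> bool) \<Rightarrow> bool \<times> (focus \<Rightarrow> bool)" where
  "exec_basic (BI f (MSet b)) r = (b, r(f := b))"
| "exec_basic (BI f MGet) r = (r f, r)"

datatype step_res = Terminated | Deadlocked | Next nat "focus \<Rightarrow> bool"

definition is_step :: "prim list \<Rightarrow> nat \<Rightarrow> (focus \<Rightarrow> bool) \<Rightarrow> step_res" where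
  "is_step X i r = (if i < 1 \<or> length X < i then Deadlocked else
     (case X ! (i - 1) of
        Halt \<Rightarrow> Terminated
      | Jump l \<Rightarrow> (if l = 0 then Deadlocked else Next (i + l) r)
      | Plain a \<Rightarrow> Next (i + 1) (snd (exec_basic a r))
      | PTest a \<Rightarrow> (case exec_basic a r of (v, r') \<Rightarrow> Next (if v then i + 1 else i + 2) r')
      | NTest a \<Rightarrow> (case exec_basic a r of (v, r') \<Rightarrow> Next (if v then i + 2 else i + 1) r')))"

fun is_config :: "prim list \<Rightarrow> (focus \<Rightarrow> bool) \<Rightarrow> nat \<Rightarrow> (nat \<times> (focus \<Rightarrow> bool)) option" where
  "is_config X r0 0 = Some (1, r0)"
| "is_config X r0 (Suc m) = (case is_config X r0 m of
      None \<Rightarrow> None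
    | Some (i, r) \<Rightarrow> (case is_step X i r of Next j r' \<Rightarrow> Some (j, r') | _ \<Rightarrow> None))"

fun basic_of :: "prim \<Rightarrow> basic option" where
  "basic_of (Plain a) = Some a"
| "basic_of (PTest a) = Some a"
| "basic_of (NTest a) = Some a"
| "basic_of (Jump l) = None"
| "basic_of Halt = None"

definition br_basic :: "basic set" where
  "br_basic = {BI (FIn i) MGet | i. 1 \<le> i} \<union> {BI (FAux i) MGet | i. 1 \<le> i}
     \<union> {BI (FAux i) (MSet b) | i b. 1 \<le> i} \<union> {BI FOut (MSet b) | b. True}"

definition IS_br :: "prim list set" where
  "IS_br = {X. X \<noteq> [] \<and> (\<forall>u\<in>set X. \<forall>a. basic_of u = Some a \<longrightarrow> a \<in> br_basic)}"

definition init_regs :: "bool list \<Rightarrow> focus \<Rightarrow> bool" where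
  "init_regs b f = (case f of FIn j \<Rightarrow> 1 \<le> j \<and> j \<le> length b \<and> b ! (j - 1) | _ \<Rightarrow> False)"

definition touches_in_beyond :: "nat \<Rightarrow> prim \<Rightarrow> bool" where
  "touches_in_beyond n u = (\<exists>j m. basic_of u = Some (BI (FIn j) m) \<and> n < j)"

definition is_computes :: "prim list \<Rightarrow> nat \<Rightarrow> (bool list \<Rightarrow> bool) \<Rightarrow> bool" where
  "is_computes X n f = (X \<in> IS_br \<and> (\<forall>b. length b = n \<longrightarrow>
     (\<exists>m i r. is_config X (init_regs b) m = Some (i, r) \<and> is_step X i r = Terminated \<and>
        r FOut = f b \<and>
        (\<forall>m'<m. \<forall>i' r'. is_config X (init_regs b) m' = Some (i', r') \<longrightarrow>
            \<not> touches_in_beyond n (X ! (i' - 1))))))"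

definition P_lis :: "(nat \<Rightarrow> bool list \<Rightarrow> bool) set" where
  "P_lis = {f. \<exists>h :: real poly. \<forall>n. \<exists>X. is_computes X n (f n) \<and>
      real (length X) \<le> poly h (real n)}"

end

theory Submission
  imports Defs
begin

text \<open>
  Both classes are nonuniform and both amount to polynomial-size circuits.  A gate is simulated by
  at most four instructions; conversely, as jumps only go forward, a single sweep over the positions
  of an instruction sequence simulates its execution, with a bounded number of gates per position.

  A circuit for 3SAT decides \<open>3SAT\<^sup>C\<close>: the clauses \<open>\<alpha>\<^sub>k(i)\<close> with \<open>b\<^sub>i = F\<close> are replaced by trivially
  satisfiable clauses with encodings of the same length, so every bit of the encoded formula is a
  function of a single input bit.

  Conversely, let \<open>w\<close> have length \<open>n\<close>.  It may mention variables with exponentially large indices,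
  so every occurrence of a variable in \<open>w\<close> is replaced by a variable named after its position,
  and clauses are added that identify occurrences of the same variable.  Well-formedness of \<open>w\<close> and
  the presence of a given clause in this formula over \<open>v\<^sub>1, \<dots>, v\<^sub>n\<close> are expressed with boundedly many
  quantifiers over positions in \<open>w\<close>, hence by polynomial-size circuits.
\<close>

section \<open>Circuits\<close>

text \<open>Both classes are translated into one predicate \<open>pfam\<close> on families of
  Boolean functions, and the two reductions are carried out inside it. It is semantic: it speaks of
  functions available on wires instead of gate lists, so a circuit arises by following the logical
  structure of a defining formula. Size bounds have the shape \<open>(n + 2) ^ c\<close>; as the
  base is at least 2, sums and constant factors are absorbed by a larger exponent.

  The obstacle shared by both reductions is that a circuit serves a single input length, so the
  length of the reduced instance must be determined by the length of the input alone. In one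
  direction this rules out simply dropping the clauses with bit False. In the other direction the
  clause-indexed problem is queried at length \<open>dd n\<close>, where
  \<open>kk (dd n) = n\<close>: there is then one input bit for each clause over n variables, and n
  variables suffice because they name positions in a word of length n.\<close>

definition wires_wf :: "nat \<Rightarrow> gate list \<Rightarrow> bool" where
  "wires_wf n C \<longleftrightarrow> (\<forall>p<length C. gate_wf n p (C ! p))"

definition avail :: "nat \<Rightarrow> gate list \<Rightarrow> (bool list \<Rightarrow> bool) \<Rightarrow> bool" where
  "avail n C f \<longleftrightarrow> (\<exists>j<length C. \<forall>w. length w = n \<longrightarrow> eval_wires w C ! j = f w)"

text \<open>One circuit offers all functions of \<open>F\<close> at once, so intermediate results
  are shared. \<open>F\<close> may be infinite: functions that agree on inputs of length n can be
  served by the same wire.\<close>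

definition gen :: "nat \<Rightarrow> nat \<Rightarrow> (bool list \<Rightarrow> bool) set \<Rightarrow> bool" where
  "gen n s F \<longleftrightarrow> (\<exists>C. wires_wf n C \<and> length C \<le> s \<and> (\<forall>f\<in>F. avail n C f))"

text \<open>The cost of \<open>f\<close> on top of any circuit that already offers \<open>G\<close>.
  The quantification over all larger \<open>F\<close> is what makes such costs add up when several
  functions are attached one after another.\<close>

definition adds :: "nat \<Rightarrow> (bool list \<Rightarrow> bool) set \<Rightarrow> nat \<Rightarrow> (bool list \<Rightarrow> bool) \<Rightarrow> bool" where
  "adds n G t f \<longleftrightarrow> (\<forall>s F. G \<subseteq> F \<longrightarrow> gen n s F \<longrightarrow> gen n (s + t) (insert f F))"

lemma eval_wires_Nil [simp]: "eval_wires w [] = []"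
  by (simp add: eval_wires_def)

lemma eval_wires_snoc [simp]:
  "eval_wires w (C @ [g]) = eval_wires w C @ [gate_val w (eval_wires w C) g]"
  by (simp add: eval_wires_def)

lemma length_eval_wires [simp]: "length (eval_wires w C) = length C"
  by (induction C rule: rev_induct) auto

lemma wires_wf_snoc [simp]:
  "wires_wf n (C @ [g]) \<longleftrightarrow> wires_wf n C \<and> gate_wf n (length C) g"
  unfolding wires_wf_def by (auto simp: nth_append less_Suc_eq)

lemma avail_snoc: "avail n C f \<Longrightarrow> avail n (C @ [g]) f"
  unfolding avail_def by (auto simp: nth_append intro!: less_SucI)

lemma gen_gate:
  assumes "gen n s F"
    and "\<And>C. wires_wf n C \<Longrightarrow> \<forall>f\<in>F. avail n C f \<Longrightarrow>
      \<exists>g. gate_wf n (length C) g \<and> (\<forall>w. length w = n \<longrightarrow> gate_val w (eval_wires w C) g = f w)"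
  shows "gen n (Suc s) (insert f F)"
proof -
  obtain C where C: "wires_wf n C" "length C \<le> s" "\<forall>f\<in>F. avail n C f"
    using assms(1) unfolding gen_def by auto
  obtain g where g: "gate_wf n (length C) g"
    "\<And>w. length w = n \<Longrightarrow> gate_val w (eval_wires w C) g = f w"
    using assms(2)[OF C(1,3)] by auto
  have "avail n (C @ [g]) f"
    unfolding avail_def using g(2) by (intro exI[of _ "length C"]) (auto simp: nth_append)
  with C g(1) show ?thesis
    unfolding gen_def by (intro exI[of _ "C @ [g]"]) (auto simp: avail_snoc)
qed

lemma gen_weaken:
  assumes "gen n s F" "s \<le> s'"
    and "\<And>f. f \<in> F' \<Longrightarrow> \<exists>g\<in>F. \<forall>w. length w = n \<longrightarrow> g w = f w"
  shows "gen n s' F'"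
proof -
  obtain C where C: "wires_wf n C" "length C \<le> s" "\<forall>f\<in>F. avail n C f"
    using assms(1) unfolding gen_def by auto
  have "avail n C f" if f: "f \<in> F'" for f
  proof -
    obtain g where g: "g \<in> F" "\<forall>w. length w = n \<longrightarrow> g w = f w" using assms(3)[OF f] by auto
    then have "avail n C g" using C(3) by simp
    with g(2) show ?thesis unfolding avail_def by auto
  qed
  with C assms(2) show ?thesis unfolding gen_def by (intro exI[of _ C]) simp
qed

lemma gen_mono: "gen n s F \<Longrightarrow> s \<le> s' \<Longrightarrow> F' \<subseteq> F \<Longrightarrow> gen n s' F'"
  by (erule gen_weaken) auto

lemma gen_empty: "gen n 0 {}"
  unfolding gen_def wires_wf_def by auto

lemma gen_const: "gen n s F \<Longrightarrow> gen n (Suc s) (insert (\<lambda>_. b) F)"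
  by (rule gen_gate) (auto intro: exI[of _ "GConst b"])

lemma gen_input: "gen n s F \<Longrightarrow> j < n \<Longrightarrow> gen n (Suc s) (insert (\<lambda>w. w ! j) F)"
  by (rule gen_gate) (auto intro: exI[of _ "GInput j"])

lemma gen_not:
  assumes "gen n s F" "f \<in> F"
  shows "gen n (Suc s) (insert (\<lambda>w. \<not> f w) F)"
proof (rule gen_gate[OF assms(1)])
  fix C assume "\<forall>f\<in>F. avail n C f"
  then have "avail n C f" using assms(2) by simp
  then obtain i where "i < length C" "\<forall>w. length w = n \<longrightarrow> eval_wires w C ! i = f w"
    unfolding avail_def by blast
  then show "\<exists>g. gate_wf n (length C) g \<and>
      (\<forall>w. length w = n \<longrightarrow> gate_val w (eval_wires w C) g = (\<not> f w))"
    by (intro exI[of _ "GNot i"]) auto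
qed

lemma gen_and:
  assumes "gen n s F" "f \<in> F" "g \<in> F"
  shows "gen n (Suc s) (insert (\<lambda>w. f w \<and> g w) F)"
proof (rule gen_gate[OF assms(1)])
  fix C assume "\<forall>f\<in>F. avail n C f"
  then have "avail n C f" "avail n C g" using assms(2,3) by simp_all
  then obtain i j where "i < length C" "\<forall>w. length w = n \<longrightarrow> eval_wires w C ! i = f w"
    "j < length C" "\<forall>w. length w = n \<longrightarrow> eval_wires w C ! j = g w"
    unfolding avail_def by blast
  then show "\<exists>h. gate_wf n (length C) h \<and>
      (\<forall>w. length w = n \<longrightarrow> gate_val w (eval_wires w C) h = (f w \<and> g w))"
    by (intro exI[of _ "GAnd i j"]) auto
qed

lemma gen_or:
  assumes "gen n s F" "f \<in> F" "g \<in> F"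
  shows "gen n (Suc s) (insert (\<lambda>w. f w \<or> g w) F)"
proof (rule gen_gate[OF assms(1)])
  fix C assume "\<forall>f\<in>F. avail n C f"
  then have "avail n C f" "avail n C g" using assms(2,3) by simp_all
  then obtain i j where "i < length C" "\<forall>w. length w = n \<longrightarrow> eval_wires w C ! i = f w"
    "j < length C" "\<forall>w. length w = n \<longrightarrow> eval_wires w C ! j = g w"
    unfolding avail_def by blast
  then show "\<exists>h. gate_wf n (length C) h \<and>
      (\<forall>w. length w = n \<longrightarrow> gate_val w (eval_wires w C) h = (f w \<or> g w))"
    by (intro exI[of _ "GOr i j"]) auto
qed

section \<open>Costs of logical connectives\<close>

lemma addsD: "adds n G t f \<Longrightarrow> gen n s F \<Longrightarrow> G \<subseteq> F \<Longrightarrow> gen n (s + t) (insert f F)"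
  unfolding adds_def by blast

lemma adds_mono: "adds n G t f \<Longrightarrow> t \<le> t' \<Longrightarrow> G \<subseteq> G' \<Longrightarrow> adds n G' t' f"
  unfolding adds_def by (intro allI impI, rule gen_mono[of _ _ "insert f F" for F]) auto

lemma adds_cong: "adds n G t f \<Longrightarrow> (\<And>w. length w = n \<Longrightarrow> f w = g w) \<Longrightarrow> adds n G t g"
  unfolding adds_def by (intro allI impI, rule gen_weaken[of _ _ "insert f F" for F]) auto

lemma adds_mem: "f \<in> G \<Longrightarrow> adds n G 0 f"
  unfolding adds_def by (auto simp: insert_absorb subsetD)

lemma adds_const: "adds n G 1 (\<lambda>_. b)"
  unfolding adds_def using gen_const by simp

lemma adds_input: "j < n \<Longrightarrow> adds n G 1 (\<lambda>w. w ! j)"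
  unfolding adds_def using gen_input by simp

lemma adds_not: 
  assumes "adds n G s f" shows "adds n G (Suc s) (\<lambda>w. \<not> f w)"
  unfolding adds_def
proof (intro allI impI)
  fix s' F assume "G \<subseteq> F" "gen n s' F"
  with assms have "gen n (s' + s) (insert f F)" by (intro addsD)
  from gen_not[OF this, of f] show "gen n (s' + Suc s) (insert (\<lambda>w. \<not> f w) F)"
    by (rule gen_mono) auto
qed

lemma adds_and: 
  assumes "adds n G s f" "adds n G t g" shows "adds n G (Suc (s + t)) (\<lambda>w. f w \<and> g w)"
  unfolding adds_def
proof (intro allI impI)
  fix s' F assume F: "G \<subseteq> F" "gen n s' F"
  with assms(1) have "gen n (s' + s) (insert f F)" by (intro addsD)
  from addsD[OF assms(2) this] F have "gen n (s' + s + t) (insert g (insert f F))" by auto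
  from gen_and[OF this, of f g] show "gen n (s' + Suc (s + t)) (insert (\<lambda>w. f w \<and> g w) F)"
    by (rule gen_mono) auto
qed

lemma adds_or: 
  assumes "adds n G s f" "adds n G t g" shows "adds n G (Suc (s + t)) (\<lambda>w. f w \<or> g w)"
  unfolding adds_def
proof (intro allI impI)
  fix s' F assume F: "G \<subseteq> F" "gen n s' F"
  with assms(1) have "gen n (s' + s) (insert f F)" by (intro addsD)
  from addsD[OF assms(2) this] F have "gen n (s' + s + t) (insert g (insert f F))" by auto
  from gen_or[OF this, of f g] show "gen n (s' + Suc (s + t)) (insert (\<lambda>w. f w \<or> g w) F)"
    by (rule gen_mono) auto
qed

text \<open>Each disjunct pays for itself and for one OR gate; the final 1 pays for the constant
  False of the empty disjunction.\<close>

lemma adds_bex: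
  assumes "finite I" "\<And>i. i \<in> I \<Longrightarrow> adds n G s (f i)"
  shows "adds n G (card I * Suc s + 1) (\<lambda>w. \<exists>i\<in>I. f i w)"
  using assms
proof (induction I rule: finite_induct)
  case empty
  show ?case using adds_const[of n G False] by simp
next
  case (insert x I)
  from insert have "adds n G (Suc (s + (card I * Suc s + 1))) (\<lambda>w. f x w \<or> (\<exists>i\<in>I. f i w))"
    by (intro adds_or) auto
  with insert show ?case by (simp add: add_ac)
qed

section \<open>Composition of circuits\<close>

lemma gen_family:
  assumes "\<And>i. i < (N::nat) \<Longrightarrow> adds n {} s (g i)"
  shows "gen n (N * s) (g ` {..<N})"
  using assms
proof (induction N)
  case 0
  then show ?case using gen_empty by simp
next
  case (Suc N)
  then have "gen n (N * s + s) (insert (g N) (g ` {..<N}))"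
    by (intro addsD[of n "{}"]) auto
  then show ?case by (simp add: lessThan_Suc add.commute)
qed

text \<open>The circuit \<open>C\<close> is replayed gate by gate on top of existing wires. Its
  input gates are replaced by the wires of the functions \<open>g i\<close>, which are already
  present, so they cost nothing; every other gate costs one.\<close>

lemma gen_compose:
  fixes g :: "nat \<Rightarrow> bool list \<Rightarrow> bool"
  assumes "gen n s F" "\<And>i. i < N \<Longrightarrow> g i \<in> F" "wires_wf N C"
  shows "gen n (s + length C)
    (F \<union> (\<lambda>j w. eval_wires (map (\<lambda>i. g i w) [0..<N]) C ! j) ` {..<length C})"
  using assms(3)
proof (induction C rule: rev_induct)
  case Nil
  then show ?case using assms(1) by simp
next
  case (snoc h C)
  define e where "e = (\<lambda>C j w. eval_wires (map (\<lambda>i. g i w) [0..<N]) C ! j)"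
  let ?F = "F \<union> e C ` {..<length C}"
  have IH: "gen n (s + length C) ?F" using snoc by (simp add: e_def)
  have h: "gate_wf N (length C) h" using snoc.prems by simp
  have old: "e (C @ [h]) j = e C j" if "j < length C" for j
    using that by (simp add: e_def nth_append)
  have new: "e (C @ [h]) (length C)
      = (\<lambda>w. gate_val (map (\<lambda>i. g i w) [0..<N]) (eval_wires (map (\<lambda>i. g i w) [0..<N]) C) h)"
    by (simp add: e_def nth_append)
  have mem: "e C j \<in> ?F" if "j < length C" for j using that by auto
  have "gen n (Suc (s + length C)) (insert (e (C @ [h]) (length C)) ?F)"
  proof (cases h)
    case (GInput j)
    with h have "e (C @ [h]) (length C) = g j" unfolding new by simp
    moreover have "g j \<in> F" using GInput h assms(2) by simp
    ultimately have "insert (e (C @ [h]) (length C)) ?F = ?F" by auto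
    with IH show ?thesis by (simp add: gen_mono[of n "s + length C"])
  next
    case (GConst b)
    then show ?thesis unfolding new using gen_const[OF IH] by simp
  next
    case (GNot i)
    then show ?thesis unfolding new using gen_not[OF IH mem[of i]] h by (simp add: e_def)
  next
    case (GAnd i j)
    then show ?thesis unfolding new using gen_and[OF IH mem[of i] mem[of j]] h by (simp add: e_def)
  next
    case (GOr i j)
    then show ?thesis unfolding new using gen_or[OF IH mem[of i] mem[of j]] h by (simp add: e_def)
  qed
  moreover have "F \<union> e (C @ [h]) ` {..<length (C @ [h])}
      \<subseteq> insert (e (C @ [h]) (length C)) ?F"
    by (auto simp: less_Suc_eq old)
  ultimately have "gen n (s + length (C @ [h])) (F \<union> e (C @ [h]) ` {..<length (C @ [h])})"
    by (elim gen_mono) auto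
  then show ?case by (simp add: e_def)
qed

lemma circuit_out_nth: "C \<noteq> [] \<Longrightarrow> circuit_out C w = eval_wires w C ! (length C - 1)"
  unfolding circuit_out_def by (metis last_conv_nth length_eval_wires length_0_conv)

lemma gen_circuit:
  assumes "gen n s F" "f \<in> F"
  shows "\<exists>C. circuit_wf n C \<and> length C \<le> Suc s \<and> (\<forall>w. length w = n \<longrightarrow> circuit_out C w = f w)"
proof -
  obtain C where C: "wires_wf n C" "length C \<le> s" "avail n C f"
    using assms unfolding gen_def by auto
  then obtain j where j: "j < length C" "\<forall>w. length w = n \<longrightarrow> eval_wires w C ! j = f w"
    unfolding avail_def by blast
  \<comment> \<open>The output of a circuit is its last wire, so wire \<open>j\<close> is copied to
    the end by an OR gate with equal inputs.\<close>
  with C have "wires_wf n (C @ [GOr j j])" by simp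
  then have "circuit_wf n (C @ [GOr j j])"
    unfolding circuit_wf_def wires_wf_def by blast
  with C j show ?thesis
    by (intro exI[of _ "C @ [GOr j j]"]) (auto simp: circuit_out_def)
qed

lemma adds_compose:
  fixes g :: "nat \<Rightarrow> bool list \<Rightarrow> bool"
  assumes "\<And>i. i < N \<Longrightarrow> adds n {} s (g i)" "circuit_wf N C"
  shows "adds n {} (N * s + length C) (\<lambda>w. circuit_out C (map (\<lambda>i. g i w) [0..<N]))"
  unfolding adds_def
proof (intro allI impI)
  fix s' F assume F: "gen n s' F"
  have "gen n (s' + K * s) (F \<union> g ` {..<K})" if "K \<le> N" for K
    using that
  proof (induction K)
    case 0
    then show ?case using F by simp
  next
    case (Suc K)
    then have "gen n (s' + K * s + s) (insert (g K) (F \<union> g ` {..<K}))"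
      by (intro addsD[of n "{}"] assms) auto
    then show ?case by (simp add: lessThan_Suc add_ac)
  qed
  from this[of N] have "gen n (s' + N * s + length C) (F \<union> g ` {..<N} \<union>
      (\<lambda>j w. eval_wires (map (\<lambda>i. g i w) [0..<N]) C ! j) ` {..<length C})"
    using assms(2) by (intro gen_compose) (auto simp: circuit_wf_def wires_wf_def)
  moreover have "C \<noteq> []" using assms(2) by (simp add: circuit_wf_def)
  ultimately show "gen n (s' + (N * s + length C))
      (insert (\<lambda>w. circuit_out C (map (\<lambda>i. g i w) [0..<N])) F)"
    by (auto simp: circuit_out_nth add_ac elim!: gen_mono)
qed

text \<open>Composition with the projections attaches a circuit given in isolation to an arbitrary
  one; the summand \<open>n\<close> pays for the input wires.\<close>

lemma circuit_adds:
  assumes "circuit_wf n C" "\<And>w. length w = n \<Longrightarrow> circuit_out C w = f w"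
  shows "adds n {} (n + length C) f"
proof -
  have "adds n {} (n * 1 + length C) (\<lambda>w. circuit_out C (map (\<lambda>i. w ! i) [0..<n]))"
    by (intro adds_compose adds_input assms(1))
  then show ?thesis
    by (rule adds_cong[OF adds_mono]) (auto simp: assms(2) map_nth)
qed

section \<open>Families of polynomial circuit size\<close>

text \<open>The parameter of type \<open>'x\<close> carries the bound variables of a formula when circuits are built
  along its quantifiers; the size bound must be uniform in it.\<close>

definition pfam :: "(nat \<Rightarrow> 'x \<Rightarrow> bool list \<Rightarrow> bool) \<Rightarrow> bool" where
  "pfam F \<longleftrightarrow> (\<exists>c. \<forall>n x. adds n {} ((n + 2) ^ c) (F n x))"

lemma pfam_cong:
  assumes "pfam F" "\<And>n x w. length w = n \<Longrightarrow> F n x w = G n x w"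
  shows "pfam G"
  using assms unfolding pfam_def by (metis adds_cong)

text \<open>For x, y at least 1, x + y + 1 is at most 4xy, and 4 is at most the square of the base
  \<open>n + 2\<close>. This closes the bounds \<open>(n + 2) ^ c\<close> under addition.\<close>

lemma power_plus_power_le: "(n + 2) ^ a + (n + 2) ^ b + 1 \<le> (n + 2 :: nat) ^ (a + b + 2)"
proof -
  let ?m = "n + 2"
  have "?m ^ a > 0" "?m ^ b > 0" by simp_all
  then obtain x y where xy: "?m ^ a = Suc x" "?m ^ b = Suc y"
    by (metis gr0_implies_Suc)
  have "?m ^ a + ?m ^ b + 1 \<le> 4 * (?m ^ a * ?m ^ b)"
    unfolding xy by simp
  also have "\<dots> \<le> ?m ^ 2 * (?m ^ a * ?m ^ b)"
    by (intro mult_right_mono) (auto simp: power2_eq_square)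
  also have "\<dots> = ?m ^ (a + b + 2)" by (simp only: power_add ac_simps)
  finally show ?thesis .
qed

lemma pfam_const: "pfam (\<lambda>n x w. P n x)"
  unfolding pfam_def
  by (rule exI[of _ 0]) (use adds_const in auto)

text \<open>The guard makes the function total in the parameter: \<open>j n x\<close> may be any
  number computed from bound variables, and positions outside the word read as False.\<close>

lemma pfam_input: "pfam (\<lambda>n x w. j n x < n \<and> w ! j n x)"
  unfolding pfam_def
proof (intro exI allI)
  fix n x
  show "adds n {} ((n + 2) ^ 0) (\<lambda>w. j n x < n \<and> w ! j n x)"
    by (cases "j n x < n") (use adds_const[of n "{}" False] adds_input[of "j n x" n] in auto)
qed

lemma pfam_not: 
  assumes "pfam F" shows "pfam (\<lambda>n x w. \<not> F n x w)"
proof -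
  obtain c where c: "\<And>n x. adds n {} ((n + 2) ^ c) (F n x)"
    using assms unfolding pfam_def by auto
  have "Suc ((n + 2) ^ c) \<le> (n + 2) ^ (c + 0 + 2)" for n :: nat
    using power_plus_power_le[of n c 0] by simp
  then have "adds n {} ((n + 2) ^ (c + 0 + 2)) (\<lambda>w. \<not> F n x w)" for n x
    by (rule adds_mono[OF adds_not[OF c]]) simp
  then show ?thesis unfolding pfam_def by blast
qed

lemma pfam_and: 
  assumes "pfam F" "pfam G" shows "pfam (\<lambda>n x w. F n x w \<and> G n x w)"
proof -
  obtain c where c: "\<forall>n x. adds n {} ((n + 2) ^ c) (F n x)"
    using assms(1) unfolding pfam_def ..
  obtain d where d: "\<forall>n x. adds n {} ((n + 2) ^ d) (G n x)"
    using assms(2) unfolding pfam_def ..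
  have "adds n {} ((n + 2) ^ (c + d + 2)) (\<lambda>w. F n x w \<and> G n x w)" for n x
  proof (rule adds_mono[OF adds_and])
    show "adds n {} ((n + 2) ^ c) (F n x)" "adds n {} ((n + 2) ^ d) (G n x)"
      using c d by simp_all
    show "Suc ((n + 2) ^ c + (n + 2) ^ d) \<le> (n + 2) ^ (c + d + 2)"
      using power_plus_power_le[of n c d] by linarith
  qed simp
  then show ?thesis unfolding pfam_def by blast
qed

lemma pfam_or: 
  assumes "pfam F" "pfam G" shows "pfam (\<lambda>n x w. F n x w \<or> G n x w)"
proof -
  have "pfam (\<lambda>n x w. \<not> (\<not> F n x w \<and> \<not> G n x w))"
    by (intro pfam_not pfam_and assms)
  then show ?thesis by simp
qed

lemma pfam_imp: 
  assumes "pfam F" "pfam G" shows "pfam (\<lambda>n x w. F n x w \<longrightarrow> G n x w)"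
proof -
  have "pfam (\<lambda>n x w. \<not> F n x w \<or> G n x w)"
    by (intro pfam_not pfam_or assms)
  then show ?thesis by (rule pfam_cong) auto
qed

lemma pfam_iff: 
  assumes "pfam F" "pfam G" shows "pfam (\<lambda>n x w. F n x w \<longleftrightarrow> G n x w)"
proof -
  have "pfam (\<lambda>n x w. (F n x w \<longrightarrow> G n x w) \<and> (G n x w \<longrightarrow> F n x w))"
    by (intro pfam_imp pfam_and assms)
  then show ?thesis by (rule pfam_cong) auto
qed

text \<open>The bound variable joins the parameter as the second component of a pair, so that one
  exponent serves all its values. The projections in the hypothesis bring the body into a shape to
  which the rules for connectives and nested quantifiers apply again.\<close>

lemma pfam_bex:
  fixes F :: "nat \<Rightarrow> 'x \<Rightarrow> 'y \<Rightarrow> bool list \<Rightarrow> bool"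
  assumes "pfam (\<lambda>n xy w. F n (fst xy) (snd xy) w)"
    and "\<And>n x. finite (I n x)" "\<And>n x. card (I n x) \<le> (n + 2) ^ e"
  shows "pfam (\<lambda>n x w. \<exists>y\<in>I n x. F n x y w)"
proof -
  obtain c where *: "\<forall>n xy. adds n {} ((n + 2) ^ c) (F n (fst xy) (snd xy))"
    using assms(1) unfolding pfam_def by blast
  have c: "adds n {} ((n + 2) ^ c) (F n x y)" for n x y
    using *[rule_format, of n "(x, y)"] by simp
  have "adds n {} ((n + 2) ^ (e + c + 2 + e)) (\<lambda>w. \<exists>y\<in>I n x. F n x y w)" for n x
  proof (rule adds_mono[OF adds_bex[OF assms(2) c]])
    have "card (I n x) * Suc ((n + 2) ^ c) + 1 \<le> (n + 2) ^ e * Suc ((n + 2) ^ c) + 1"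
      using assms(3) by (intro add_right_mono mult_right_mono) auto
    also have "\<dots> = (n + 2) ^ (e + c) + (n + 2) ^ e + 1"
      by (simp add: power_add)
    also have "\<dots> \<le> (n + 2) ^ (e + c + e + 2)"
      by (rule power_plus_power_le)
    finally show "card (I n x) * Suc ((n + 2) ^ c) + 1 \<le> (n + 2) ^ (e + c + 2 + e)"
      by (simp add: add_ac)
  qed auto
  then show ?thesis unfolding pfam_def by blast
qed

lemma pfam_ball:
  fixes F :: "nat \<Rightarrow> 'x \<Rightarrow> 'y \<Rightarrow> bool list \<Rightarrow> bool"
  assumes "pfam (\<lambda>n xy w. F n (fst xy) (snd xy) w)"
    and "\<And>n x. finite (I n x)" "\<And>n x. card (I n x) \<le> (n + 2) ^ e"
  shows "pfam (\<lambda>n x w. \<forall>y\<in>I n x. F n x y w)"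
proof -
  have "pfam (\<lambda>n x w. \<not> (\<exists>y\<in>I n x. \<not> F n x y w))"
    by (intro pfam_not pfam_bex[where e = e] assms)
  then show ?thesis by simp
qed

lemma circuits_imp_pfam:
  assumes "\<forall>n. \<exists>C. circuit_wf n C \<and> length C \<le> (n + 2) ^ c \<and>
    (\<forall>w. length w = n \<longrightarrow> circuit_out C w = f n w)"
  shows "pfam (\<lambda>n (_ :: unit). f n)"
  unfolding pfam_def
proof (intro exI allI)
  fix n :: nat
  obtain C where C: "circuit_wf n C" "length C \<le> (n + 2) ^ c"
    "\<And>w. length w = n \<Longrightarrow> circuit_out C w = f n w" using assms by meson
  have "n + length C \<le> (n + 2) ^ (1 + c + 2)"
    using power_plus_power_le[of n 1 c] C(2) unfolding power_one_right by linarith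
  then show "adds n {} ((n + 2) ^ (1 + c + 2)) (f n)"
    using adds_mono[OF circuit_adds[OF C(1,3)]] by blast
qed

lemma pfam_imp_circuits:
  assumes "pfam (\<lambda>n (_ :: unit). f n)"
  shows "\<exists>c. \<forall>n. \<exists>C. circuit_wf n C \<and> length C \<le> (n + 2) ^ c \<and>
    (\<forall>w. length w = n \<longrightarrow> circuit_out C w = f n w)"
proof -
  obtain c where c: "\<And>n. adds n {} ((n + 2) ^ c) (f n)"
    using assms unfolding pfam_def by auto
  have "\<exists>C. circuit_wf n C \<and> length C \<le> (n + 2) ^ (c + 0 + 2) \<and>
    (\<forall>w. length w = n \<longrightarrow> circuit_out C w = f n w)" for n
  proof -
    obtain C where "circuit_wf n C" "length C \<le> Suc (0 + (n + 2) ^ c)"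
      "\<forall>w. length w = n \<longrightarrow> circuit_out C w = f n w"
      using gen_circuit[OF addsD[OF c gen_empty], where f = "f n"] by auto
    moreover have "Suc (0 + (n + 2) ^ c) \<le> (n + 2) ^ (c + 0 + 2)"
      using power_plus_power_le[of n c 0] by linarith
    ultimately show ?thesis using le_trans by blast
  qed
  then show ?thesis by blast
qed

text \<open>The nonuniform counterpart of a many-one reduction: an instance of length n is mapped to
  one of length \<open>N n\<close>, whose bits are computed by small circuits.\<close>

lemma pfam_compose:
  fixes g :: "nat \<Rightarrow> nat \<Rightarrow> bool list \<Rightarrow> bool"
  assumes f: "pfam (\<lambda>n (_ :: unit). f n)" and g: "pfam g" and N: "\<And>n. N n \<le> (n + 2) ^ d"
  shows "pfam (\<lambda>n x w. f (N n) (map (\<lambda>i. g n i w) [0..<N n]))"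
proof -
  obtain c where c: "\<forall>n. \<exists>C. circuit_wf n C \<and> length C \<le> (n + 2) ^ c \<and>
    (\<forall>w. length w = n \<longrightarrow> circuit_out C w = f n w)"
    using pfam_imp_circuits[OF f] ..
  obtain b where "\<forall>n i. adds n {} ((n + 2) ^ b) (g n i)"
    using g unfolding pfam_def ..
  then have b: "adds n {} ((n + 2) ^ b) (g n i)" for n i by simp
  \<comment> \<open>The part \<open>d + b\<close> bounds the \<open>N n\<close> circuits for the
    bits of the new instance. The part \<open>(d + 2) * c\<close> bounds the circuit for
    \<open>f\<close> at length \<open>N n\<close>, because \<open>N n + 2\<close> is at most
    \<open>(n + 2) ^ (d + 2)\<close>. The last 2 absorbs the sum.\<close>
  have "adds n {} ((n + 2) ^ ((d + b) + (d + 2) * c + 2))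
      (\<lambda>w. f (N n) (map (\<lambda>i. g n i w) [0..<N n]))" for n
  proof -
    obtain C where C: "circuit_wf (N n) C" "length C \<le> (N n + 2) ^ c"
      "\<And>w. length w = N n \<Longrightarrow> circuit_out C w = f (N n) w" using c[rule_format, of "N n"] by blast
    have "N n + 2 \<le> (n + 2) ^ (d + 2)"
      using N[of n] power_plus_power_le[of n d 0] unfolding power_0 add_0_right by linarith
    then have "(N n + 2) ^ c \<le> (n + 2) ^ ((d + 2) * c)"
      unfolding power_mult by (rule power_mono) simp
    moreover have "N n * (n + 2) ^ b \<le> (n + 2) ^ (d + b)"
      unfolding power_add by (rule mult_right_mono[OF N]) simp
    ultimately have "N n * (n + 2) ^ b + length C \<le> (n + 2) ^ ((d + b) + (d + 2) * c + 2)"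
      using add_mono[OF _ order_trans[OF C(2)]] power_plus_power_le[of n "d + b" "(d + 2) * c"]
      by (meson add_leD1 order_trans)
    note size = this
    have "adds n {} (N n * (n + 2) ^ b + length C)
      (\<lambda>w. circuit_out C (map (\<lambda>i. g n i w) [0..<N n]))"
      by (intro adds_compose b C(1))
    from adds_mono[OF this size subset_refl]
    have "adds n {} ((n + 2) ^ ((d + b) + (d + 2) * c + 2))
      (\<lambda>w. circuit_out C (map (\<lambda>i. g n i w) [0..<N n]))" .
    then show ?thesis by (rule adds_cong) (simp add: C(3))
  qed
  then show ?thesis unfolding pfam_def by (intro exI allI)
qed

section \<open>Comparison with P/poly\<close>

text \<open>Induction along the Horner form \<open>a + x * h(x)\<close>: the coefficient
  \<open>a\<close> lies below some power of 2, hence of \<open>n + 2\<close>, and multiplication by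
  \<open>n\<close> raises the exponent by one.\<close>

lemma poly_le_power: "\<exists>c. \<forall>n. poly h (real n) \<le> real ((n + 2) ^ c)"
proof (induction h)
  case 0
  show ?case by simp
next
  case (pCons a h)
  then obtain c where c: "\<And>n. poly h (real n) \<le> real ((n + 2) ^ c)" by blast
  obtain k where k: "a \<le> 2 ^ k" using real_arch_pow[of 2 a] by (auto intro: less_imp_le)
  have "poly (pCons a h) (real n) \<le> real ((n + 2) ^ (k + (c + 1) + 2))" for n
  proof -
    have "real n * poly h (real n) \<le> real n * real ((n + 2) ^ c)"
      using c by (intro mult_left_mono) auto
    also have "\<dots> \<le> real ((n + 2) ^ (c + 1))" by (simp add: mult_right_mono)
    finally have 1: "real n * poly h (real n) \<le> real ((n + 2) ^ (c + 1))" .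
    have "a \<le> real ((n + 2) ^ k)"
    proof (rule order_trans[OF k])
      show "2 ^ k \<le> real ((n + 2) ^ k)" by (auto intro: power_mono)
    qed
    then have "a + real n * poly h (real n) \<le> real ((n + 2) ^ k + (n + 2) ^ (c + 1) + 1)"
      using 1 by simp
    also have "\<dots> \<le> real ((n + 2) ^ (k + (c + 1) + 2))"
      by (subst of_nat_le_iff) (rule power_plus_power_le)
    finally show ?thesis by simp
  qed
  then show ?case by blast
qed

lemma power_as_poly: "real ((n + 2) ^ c) = poly ([:2, 1:] ^ c) (real n)"
  by (simp add: poly_power add_ac)

lemma P_poly_iff_pfam: "L \<in> P_poly \<longleftrightarrow> pfam (\<lambda>n (_ :: unit) w. w \<in> L)"
proof
  assume "L \<in> P_poly"
  then obtain h where h: "\<And>n. \<exists>C. circuit_wf n C \<and> real (length C) \<le> poly h (real n) \<and>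
      (\<forall>w. length w = n \<longrightarrow> (circuit_out C w \<longleftrightarrow> w \<in> L))"
    unfolding P_poly_def by auto
  obtain c where "\<And>n. poly h (real n) \<le> real ((n + 2) ^ c)" using poly_le_power by blast
  then have "real s \<le> poly h (real n) \<Longrightarrow> s \<le> (n + 2) ^ c" for s n
    using order_trans of_nat_le_iff by blast
  with h show "pfam (\<lambda>n (_ :: unit) w. w \<in> L)"
    by (intro circuits_imp_pfam[of c]) blast
next
  assume "pfam (\<lambda>n (_ :: unit) w. w \<in> L)"
  from pfam_imp_circuits[OF this] obtain c where "\<forall>n. \<exists>C. circuit_wf n C \<and>
      length C \<le> (n + 2) ^ c \<and> (\<forall>w. length w = n \<longrightarrow> circuit_out C w = (w \<in> L))" by blast
  then show "L \<in> P_poly"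
    unfolding P_poly_def mem_Collect_eq
    by (intro exI[of _ "[:2, 1:] ^ c"]) (simp only: power_as_poly[symmetric] of_nat_le_iff simp_thms)
qed

section \<open>Instruction sequences\<close>

definition reach :: "prim list \<Rightarrow> (focus \<Rightarrow> bool) \<Rightarrow> nat \<Rightarrow> (focus \<Rightarrow> bool) \<Rightarrow> bool" where
  "reach X r0 i r \<longleftrightarrow> (\<exists>m. is_config X r0 m = Some (i, r))"

lemma reach_step: "reach X r0 i r \<Longrightarrow> is_step X i r = Next j r' \<Longrightarrow> reach X r0 j r'"
  unfolding reach_def
proof (elim exE)
  fix m assume "is_config X r0 m = Some (i, r)" "is_step X i r = Next j r'"
  then have "is_config X r0 (Suc m) = Some (j, r')" by simp
  then show "\<exists>m. is_config X r0 m = Some (j, r')" ..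
qed

text \<open>The invariant of the simulation: register \<open>FAux (Suc p)\<close> holds wire
  \<open>p\<close>, since auxiliary registers are numbered from 1, and the registers of wires not
  yet computed are still False.\<close>

definition wire_regs :: "bool list \<Rightarrow> bool list \<Rightarrow> focus \<Rightarrow> bool" where
  "wire_regs b vs f = (case f of FAux i \<Rightarrow> 1 \<le> i \<and> i \<le> length vs \<and> vs ! (i - 1) | _ \<Rightarrow> init_regs b f)"

lemma wire_regs_Nil: "wire_regs b [] = init_regs b"
  by (auto simp: wire_regs_def init_regs_def fun_eq_iff split: focus.splits)

text \<open>As auxiliary registers start with False, a wire with value False requires no write.
  Hence the code of a gate writes at most once, and only the value True.\<close>

lemma wire_regs_snoc_False: "wire_regs b (vs @ [False]) = wire_regs b vs"
  by (auto simp: wire_regs_def fun_eq_iff nth_append split: focus.splits)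

lemma wire_regs_snoc_True:
  "wire_regs b (vs @ [True]) = (wire_regs b vs)(FAux (Suc (length vs)) := True)"
  by (auto simp: wire_regs_def fun_eq_iff nth_append split: focus.splits)

lemma wire_regs_aux: "i < length vs \<Longrightarrow> wire_regs b vs (FAux (Suc i)) = vs ! i"
  by (simp add: wire_regs_def)

lemma wire_regs_in: "j < length b \<Longrightarrow> wire_regs b vs (FIn (Suc j)) = b ! j"
  by (simp add: wire_regs_def init_regs_def)

abbreviation get_in :: "nat \<Rightarrow> basic" where "get_in j \<equiv> BI (FIn (Suc j)) MGet"
abbreviation get_aux :: "nat \<Rightarrow> basic" where "get_aux i \<equiv> BI (FAux (Suc i)) MGet"
abbreviation set_aux :: "nat \<Rightarrow> prim" where "set_aux i \<equiv> Plain (BI (FAux (Suc i)) (MSet True))"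

text \<open>A nonempty block ends with the write of True, which is skipped when the gate has value
  False. In the AND block, \<open>Jump 3\<close> leads just behind the block; in the OR block,
  \<open>Jump 2\<close> leads to the write.\<close>

fun gate_code :: "nat \<Rightarrow> gate \<Rightarrow> prim list" where
  "gate_code p (GInput j) = [PTest (get_in j), set_aux p]"
| "gate_code p (GConst b) = (if b then [set_aux p] else [])"
| "gate_code p (GNot i) = [NTest (get_aux i), set_aux p]"
| "gate_code p (GAnd i j) = [NTest (get_aux i), Jump 3, PTest (get_aux j), set_aux p]"
| "gate_code p (GOr i j) = [PTest (get_aux i), Jump 2, PTest (get_aux j), set_aux p]"

lemma length_gate_code: "length (gate_code p g) \<le> 4"
  by (cases g) auto

text \<open>Symbolic execution, by cases on the gate and on the values of its arguments. Every path
  leaves the block at the position directly behind it, so blocks can be concatenated without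
  adjusting jumps.\<close>

lemma reach_gate_code:
  assumes "reach X r0 (Suc (length A)) (wire_regs b vs)"
    and X: "X = A @ gate_code (length vs) g @ B"
    and "gate_wf (length b) (length vs) g"
  shows "reach X r0 (Suc (length (A @ gate_code (length vs) g)))
    (wire_regs b (vs @ [gate_val b vs g]))"
proof -
  let ?k = "length A" and ?r = "wire_regs b vs"
  let ?r' = "?r(FAux (Suc (length vs)) := True)"
  have set: "reach X r0 (Suc i) ?r'"
    if "reach X r0 i ?r" "0 < i" "i \<le> length X" "X ! (i - 1) = set_aux (length vs)" for i
    using that by (intro reach_step[OF that(1)]) (simp add: is_step_def)
  note step = reach_step[OF assms(1)]
  show ?thesis
  proof (cases g)
    case (GInput j)
    show ?thesis
    proof (cases "b ! j")
      case True
      have "reach X r0 (?k + 2) ?r"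
        by (rule step) (use GInput X assms(3) True in \<open>auto simp: is_step_def nth_append wire_regs_in\<close>)
      from set[OF this] show ?thesis
        using GInput X True by (simp add: nth_append wire_regs_snoc_True eval_nat_numeral)
    next
      case False
      have "reach X r0 (?k + 3) ?r"
        by (rule step) (use GInput X assms(3) False in \<open>auto simp: is_step_def nth_append wire_regs_in\<close>)
      then show ?thesis
        using GInput False by (simp add: wire_regs_snoc_False eval_nat_numeral)
    qed
  next
    case (GConst c)
    show ?thesis
      using set[OF assms(1)] GConst X assms(1)
      by (auto simp: nth_append wire_regs_snoc_True wire_regs_snoc_False)
  next
    case (GNot i)
    show ?thesis
    proof (cases "vs ! i")
      case False
      have "reach X r0 (?k + 2) ?r"
        by (rule step) (use GNot X assms(3) False in \<open>auto simp: is_step_def nth_append wire_regs_aux\<close>)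
      from set[OF this] show ?thesis
        using GNot X False by (simp add: nth_append wire_regs_snoc_True eval_nat_numeral)
    next
      case True
      have "reach X r0 (?k + 3) ?r"
        by (rule step) (use GNot X assms(3) True in \<open>auto simp: is_step_def nth_append wire_regs_aux\<close>)
      then show ?thesis
        using GNot True by (simp add: wire_regs_snoc_False eval_nat_numeral)
    qed
  next
    case (GAnd i j)
    show ?thesis
    proof (cases "vs ! i")
      case i: True
      have *: "reach X r0 (?k + 3) ?r"
        by (rule step) (use GAnd X assms(3) i in \<open>auto simp: is_step_def nth_append wire_regs_aux\<close>)
      show ?thesis
      proof (cases "vs ! j")
        case True
        have "reach X r0 (?k + 4) ?r"
          by (rule reach_step[OF *])
            (use GAnd X assms(3) True in \<open>auto simp: is_step_def nth_append wire_regs_aux\<close>)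
        from set[OF this] show ?thesis
          using GAnd X i True by (simp add: nth_append wire_regs_snoc_True eval_nat_numeral)
      next
        case False
        have "reach X r0 (?k + 5) ?r"
          by (rule reach_step[OF *])
            (use GAnd X assms(3) False in \<open>auto simp: is_step_def nth_append wire_regs_aux\<close>)
        then show ?thesis
          using GAnd False by (simp add: wire_regs_snoc_False eval_nat_numeral)
      qed
    next
      case i: False
      have *: "reach X r0 (?k + 2) ?r"
        by (rule step) (use GAnd X assms(3) i in \<open>auto simp: is_step_def nth_append wire_regs_aux\<close>)
      have "reach X r0 (?k + 5) ?r"
        by (rule reach_step[OF *]) (use GAnd X in \<open>auto simp: is_step_def nth_append\<close>)
      then show ?thesis
        using GAnd i by (simp add: wire_regs_snoc_False eval_nat_numeral)
    qed
  next
    case (GOr i j)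
    show ?thesis
    proof (cases "vs ! i")
      case i: False
      have *: "reach X r0 (?k + 3) ?r"
        by (rule step) (use GOr X assms(3) i in \<open>auto simp: is_step_def nth_append wire_regs_aux\<close>)
      show ?thesis
      proof (cases "vs ! j")
        case True
        have "reach X r0 (?k + 4) ?r"
          by (rule reach_step[OF *])
            (use GOr X assms(3) True in \<open>auto simp: is_step_def nth_append wire_regs_aux\<close>)
        from set[OF this] show ?thesis
          using GOr X True by (simp add: nth_append wire_regs_snoc_True eval_nat_numeral)
      next
        case False
        have "reach X r0 (?k + 5) ?r"
          by (rule reach_step[OF *])
            (use GOr X assms(3) False in \<open>auto simp: is_step_def nth_append wire_regs_aux\<close>)
        then show ?thesis
          using GOr i False by (simp add: wire_regs_snoc_False eval_nat_numeral)
      qed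
    next
      case i: True
      have *: "reach X r0 (?k + 2) ?r"
        by (rule step) (use GOr X assms(3) i in \<open>auto simp: is_step_def nth_append wire_regs_aux\<close>)
      have "reach X r0 (?k + 4) ?r"
        by (rule reach_step[OF *]) (use GOr X in \<open>auto simp: is_step_def nth_append\<close>)
      from set[OF this] show ?thesis
        using GOr X i by (simp add: nth_append wire_regs_snoc_True eval_nat_numeral)
    qed
  qed
qed

definition wires_code :: "gate list \<Rightarrow> prim list" where
  "wires_code C = concat (map (\<lambda>p. gate_code p (C ! p)) [0..<length C])"

lemma wires_code_Nil [simp]: "wires_code [] = []"
  by (simp add: wires_code_def)

lemma wires_code_snoc [simp]: "wires_code (C @ [g]) = wires_code C @ gate_code (length C) g"
  unfolding wires_code_def
  by (simp add: nth_append) (rule arg_cong[where f = concat], simp)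

lemma length_wires_code: "length (wires_code C) \<le> 4 * length C"
proof (induction C rule: rev_induct)
  case (snoc g C)
  then show ?case using length_gate_code[of "length C" g] by simp
qed simp

text \<open>The continuation \<open>B\<close> is arbitrary because in the induction step the code of
  the last gate becomes part of the continuation of the code before it.\<close>

lemma reach_wires_code:
  assumes "wires_wf (length b) C"
  shows "reach (wires_code C @ B) (init_regs b) (Suc (length (wires_code C)))
    (wire_regs b (eval_wires b C))"
  using assms
proof (induction C arbitrary: B rule: rev_induct)
  case Nil
  show ?case unfolding reach_def by (rule exI[of _ 0]) (simp add: wire_regs_Nil)
next
  case (snoc g C)
  let ?X = "wires_code C @ gate_code (length (eval_wires b C)) g @ B"
  have "reach ?X (init_regs b) (Suc (length (wires_code C))) (wire_regs b (eval_wires b C))"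
    by (rule snoc.IH) (use snoc.prems in simp)
  from reach_gate_code[OF this refl] show ?case using snoc.prems by simp
qed

lemma circuit_imp_is_computes:
  assumes "circuit_wf n C"
  shows "\<exists>X. is_computes X n (circuit_out C) \<and> length X \<le> 4 * length C + 3"
proof -
  \<comment> \<open>The output register also starts with False, so it is written only if the last
    wire is True; otherwise the test skips directly to \<open>Halt\<close>.\<close>
  define B where "B = [PTest (get_aux (length C - 1)), Plain (BI FOut (MSet True)), Halt]"
  define X where "X = wires_code C @ B"
  have C: "wires_wf n C" "C \<noteq> []" using assms by (auto simp: circuit_wf_def wires_wf_def)
  have gate: "\<forall>u\<in>set (gate_code p g). (\<forall>a. basic_of u = Some a \<longrightarrow> a \<in> br_basic) \<and>
      \<not> touches_in_beyond n u" if "gate_wf n p g" for p g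
    using that by (cases g) (auto simp: br_basic_def touches_in_beyond_def)
  have "\<forall>u\<in>set (wires_code C). (\<forall>a. basic_of u = Some a \<longrightarrow> a \<in> br_basic) \<and>
      \<not> touches_in_beyond n u"
  proof
    fix u assume "u \<in> set (wires_code C)"
    then obtain p where "p < length C" "u \<in> set (gate_code p (C ! p))"
      by (auto simp: wires_code_def)
    with gate[of p "C ! p"] C(1) show "(\<forall>a. basic_of u = Some a \<longrightarrow> a \<in> br_basic) \<and>
      \<not> touches_in_beyond n u" by (auto simp: wires_wf_def)
  qed
  then have X: "\<forall>u\<in>set X. (\<forall>a. basic_of u = Some a \<longrightarrow> a \<in> br_basic) \<and> \<not> touches_in_beyond n u"
    by (auto simp: X_def B_def br_basic_def touches_in_beyond_def)
  have "\<exists>m i r. is_config X (init_regs b) m = Some (i, r) \<and> is_step X i r = Terminated \<and>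
      r FOut = circuit_out C b \<and> (\<forall>m'<m. \<forall>i' r'. is_config X (init_regs b) m' = Some (i', r') \<longrightarrow>
            \<not> touches_in_beyond n (X ! (i' - 1)))" if b: "length b = n" for b
  proof -
    let ?k = "length (wires_code C)" and ?r = "wire_regs b (eval_wires b C)"
    have val: "?r (FAux (Suc (length C - 1))) = circuit_out C b"
      using C(2) wire_regs_aux[of "length C - 1" "eval_wires b C" b] circuit_out_nth[OF C(2), of b]
      by (metis diff_less length_eval_wires length_greater_0_conv zero_less_one)
    have 0: "reach X (init_regs b) (?k + 1) ?r"
      using reach_wires_code[of b C B] b C(1) by (simp add: X_def)
    have out: "?r FOut = False" by (simp add: wire_regs_def init_regs_def)
    have "\<exists>r. reach X (init_regs b) (?k + 3) r \<and> r FOut = circuit_out C b"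
    proof (cases "circuit_out C b")
      case True
      have "reach X (init_regs b) (?k + 2) ?r"
        by (rule reach_step[OF 0]) (use val True in \<open>simp add: is_step_def X_def B_def nth_append\<close>)
      then have "reach X (init_regs b) (?k + 3) (?r(FOut := True))"
        by (rule reach_step) (simp add: is_step_def X_def B_def nth_append)
      with True show ?thesis by (intro exI[of _ "?r(FOut := True)"]) auto
    next
      case False
      have "reach X (init_regs b) (?k + 3) ?r"
        by (rule reach_step[OF 0]) (use val False in \<open>simp add: is_step_def X_def B_def nth_append\<close>)
      with False out show ?thesis by (intro exI[of _ ?r]) simp
    qed
    then obtain r where r: "reach X (init_regs b) (?k + 3) r" "r FOut = circuit_out C b" by auto
    then obtain m where m: "is_config X (init_regs b) m = Some (?k + 3, r)"
      unfolding reach_def by auto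
    have "is_step X (?k + 3) r = Terminated" by (simp add: is_step_def X_def B_def nth_append)
    moreover have "\<not> touches_in_beyond n (X ! (i' - 1))"
      if "m' < m" "is_config X (init_regs b) m' = Some (i', r')" for m' i' r'
    proof -
      have mono: "is_config X (init_regs b) m1 = None \<Longrightarrow> is_config X (init_regs b) (m1 + d) = None"
        for m1 d by (induction d) auto
      \<comment> \<open>A missing configuration stays missing, but the one at step \<open>m\<close>
        exists. So execution did not deadlock at \<open>i'\<close>, which is therefore a genuine
        position of \<open>X\<close>.\<close>
      have "is_config X (init_regs b) (Suc m') \<noteq> None"
      proof
        assume "is_config X (init_regs b) (Suc m') = None"
        from mono[OF this, of "m - Suc m'"] show False using m that(1)
          by (simp del: is_config.simps)
      qed
      then have "1 \<le> i' \<and> i' \<le> length X"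
        using that(2) by (auto simp: is_step_def split: if_splits)
      then have "X ! (i' - 1) \<in> set X" by auto
      with X show ?thesis by blast
    qed
    ultimately show ?thesis using r m by (intro exI[of _ m] exI[of _ "?k + 3"] exI[of _ r]) auto
  qed
  moreover have "X \<in> IS_br" using X by (simp add: IS_br_def X_def B_def)
  moreover have "length X \<le> 4 * length C + 3"
    using length_wires_code[of C] by (simp add: X_def B_def)
  ultimately show ?thesis
    unfolding is_computes_def by (intro exI[of _ X]) simp
qed

section \<open>From instruction sequences to circuits\<close>

text \<open>The first component is the position to be executed next; the sweep skips all positions before it.\<close>

fun sweep :: "prim list \<Rightarrow> (focus \<Rightarrow> bool) \<Rightarrow> nat \<Rightarrow> nat \<times> (focus \<Rightarrow> bool)" where
  "sweep X r 0 = (1, r)"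
| "sweep X r (Suc i) = (if fst (sweep X r i) = Suc i then
     (case is_step X (Suc i) (snd (sweep X r i)) of Next j r' \<Rightarrow> (j, r') | _ \<Rightarrow> sweep X r i)
   else sweep X r i)"

lemma is_step_Next_gt: "is_step X i r = Next j r' \<Longrightarrow> i < j"
  by (auto simp: is_step_def split: if_splits prim.splits prod.splits)

lemma sweep_wait:
  assumes "sweep X r i = (j, r')" "i \<le> t" "t < j"
  shows "sweep X r t = (j, r')"
proof -
  have "i + d < j \<Longrightarrow> sweep X r (i + d) = (j, r')" for d
    by (induction d) (auto simp: assms(1))
  from this[of "t - i"] assms(2,3) show ?thesis by simp
qed

text \<open>The step number \<open>m\<close> and the position \<open>i\<close> drift apart at jumps
  and skips. The sweep bridges the gap by waiting: its state after \<open>i - 1\<close> positions is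
  the configuration in which position \<open>i\<close> is about to be executed.\<close>

lemma sweep_config:
  "is_config X r0 m = Some (i, r) \<Longrightarrow> 1 \<le> i \<and> sweep X r0 (i - 1) = (i, r)"
proof (induction m arbitrary: i r)
  case 0
  then show ?case by simp
next
  case (Suc m)
  then obtain i' r' where i': "is_config X r0 m = Some (i', r')" "is_step X i' r' = Next i r"
    by (auto split: option.splits step_res.splits)
  from Suc.IH[OF i'(1)] have *: "1 \<le> i'" "sweep X r0 (i' - 1) = (i', r')" by auto
  then have "sweep X r0 i' = (i, r)" using i'(2) by (cases i') auto
  from sweep_wait[OF this, of "i - 1"] is_step_Next_gt[OF i'(2)] show ?case by simp
qed

text \<open>At a terminating instruction the sweep keeps its state, and the recorded position is
  never visited again. So the final registers can be read off after the whole sweep, wherever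
  execution stopped.\<close>

lemma sweep_terminated:
  assumes "is_config X r0 m = Some (i, r)" "is_step X i r = Terminated"
  shows "sweep X r0 (length X) = (i, r)"
proof -
  have i: "1 \<le> i" "i \<le> length X"
    using assms(2) unfolding is_step_def by (metis not_le step_res.distinct(1))+
  have 0: "sweep X r0 i = (i, r)"
    using sweep_config[OF assms(1)] assms(2) by (cases i) simp_all
  have "sweep X r0 (i + d) = (i, r)" for d
    by (induction d) (simp_all add: 0)
  from this[of "length X - i"] i show ?thesis by simp
qed


text \<open>A function of one bit is constant, the identity or the negation, so at most one gate is
  needed beyond the one paid for \<open>v\<close>.\<close>

lemma adds_unary:
  assumes "adds n G 1 v"
  shows "adds n G 2 (\<lambda>w. B (v w))"
proof -
  consider "\<And>x. B x = B True" | "\<And>x. B x = x" | "\<And>x. B x = (\<not> x)"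
    by (cases "B True"; cases "B False") (metis (full_types))+
  then show ?thesis
  proof cases
    case 1
    then have "(\<lambda>w. B (v w)) = (\<lambda>w. B True)" by (intro HOL.ext)
    then show ?thesis using adds_mono[OF adds_const[of n G "B True"]] by simp
  next
    case 2
    then have "(\<lambda>w. B (v w)) = v" by (intro HOL.ext)
    then show ?thesis using adds_mono[OF assms] by simp
  next
    case 3
    then have "(\<lambda>w. B (v w)) = (\<lambda>w. \<not> v w)" by (intro HOL.ext)
    then show ?thesis using adds_not[OF assms] by (simp add: numeral_2_eq_2)
  qed
qed

text \<open>One instruction step is split into the reply, the successor position and the effect on
  the registers. The successor depends on the registers only through the single bit of the reply,
  which makes it cheap for a circuit.\<close>

definition next_pos :: "prim \<Rightarrow> bool \<Rightarrow> nat \<Rightarrow> nat \<Rightarrow> bool" where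
  "next_pos u v p j = (case u of Halt \<Rightarrow> False | Jump l \<Rightarrow> l \<noteq> 0 \<and> j = p + l
     | Plain a \<Rightarrow> j = p + 1 | PTest a \<Rightarrow> j = (if v then p + 1 else p + 2)
     | NTest a \<Rightarrow> j = (if v then p + 2 else p + 1))"

definition reply :: "prim \<Rightarrow> (focus \<Rightarrow> bool) \<Rightarrow> bool" where
  "reply u r = (case basic_of u of None \<Rightarrow> False | Some a \<Rightarrow> fst (exec_basic a r))"

definition effect :: "prim \<Rightarrow> (focus \<Rightarrow> bool) \<Rightarrow> focus \<Rightarrow> bool" where
  "effect u r = (case basic_of u of None \<Rightarrow> r | Some a \<Rightarrow> snd (exec_basic a r))"

lemma sweep_pc:
  assumes "Suc i \<le> length X" "Suc i < j"
  shows "fst (sweep X r (Suc i)) = j \<longleftrightarrow> fst (sweep X r i) = j \<or>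
    fst (sweep X r i) = Suc i \<and> next_pos (X ! i) (reply (X ! i) (snd (sweep X r i))) (Suc i) j"
  using assms by (cases "X ! i") (auto simp: is_step_def next_pos_def reply_def split: prod.splits)

lemma sweep_reg:
  assumes "Suc i \<le> length X"
  shows "snd (sweep X r (Suc i)) = (if fst (sweep X r i) = Suc i
    then effect (X ! i) (snd (sweep X r i)) else snd (sweep X r i))"
  using assms by (cases "X ! i") (auto simp: is_step_def effect_def split: prod.splits)

text \<open>The wires describe whether the pending position is \<open>j\<close>, for the
  \<open>j\<close> still ahead, and the contents of all registers. Initially the n inputs and the
  two constants cover all of them. One instruction can change one register and the wires of three
  positions; each of these four functions costs at most 4 gates, hence 16 per position. Everything
  else keeps its wire, which is why infinitely many functions cause no cost.\<close>

lemma sweep_gen: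
  fixes X :: "prim list" and n :: nat
  defines "pc \<equiv> \<lambda>i j b. fst (sweep X (init_regs b) i) = j"
    and "rg \<equiv> \<lambda>i f b. snd (sweep X (init_regs b) i) f"
  shows "gen n (n + 2 + 16 * i) ({pc i j | j. i < j} \<union> range (rg i))"
proof (induction i)
  case 0
  have "gen n (n * 1) ((\<lambda>j w. w ! j) ` {..<n})"
    by (rule gen_family) (rule adds_input, simp)
  from gen_const[OF gen_const[OF this, of True], of False]
  have *: "gen n (Suc (Suc (n * 1)))
     (insert (\<lambda>_. False) (insert (\<lambda>_. True) ((\<lambda>j w. w ! j) ` {..<n})))" (is "gen _ _ ?F") .
  show ?case
  proof (rule gen_weaken[OF *])
    fix g assume "g \<in> {pc 0 j | j. 0 < j} \<union> range (rg 0)"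
    then consider j where "g = pc 0 j" | f where "g = rg 0 f" by auto
    then show "\<exists>h\<in>?F. \<forall>w. length w = n \<longrightarrow> h w = g w"
    proof cases
      case 1
      then show ?thesis by (cases "j = 1") (simp_all add: pc_def)
    next
      case 2
      show ?thesis
      proof (cases "\<exists>j<n. f = FIn (Suc j)")
        case True
        then obtain j where "j < n" "f = FIn (Suc j)" by auto
        with 2 show ?thesis by (intro bexI[of _ "\<lambda>w. w ! j"]) (auto simp: rg_def init_regs_def)
      next
        case False
        have "\<forall>w. length w = n \<longrightarrow> \<not> g w"
        proof (cases f)
          case (FIn j)
          with False 2 show ?thesis by (cases j) (auto simp: rg_def init_regs_def)
        qed (simp_all add: 2 rg_def init_regs_def)
        then show ?thesis by simp
      qed
    qed
  qed simp
next
  case (Suc i)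
  let ?F = "{pc i j | j. i < j} \<union> range (rg i)"
  let ?F' = "{pc (Suc i) j | j. Suc i < j} \<union> range (rg (Suc i))"
  show ?case
  proof (cases "Suc i \<le> length X")
    case False
    then have "is_step X (Suc i) r = Deadlocked" for r by (simp add: is_step_def)
    then have "sweep X r (Suc i) = sweep X r i" for r by simp
    then have "pc (Suc i) = pc i" "rg (Suc i) = rg i"
      by (simp_all add: pc_def rg_def del: sweep.simps)
    then have "?F' \<subseteq> ?F" by auto
    then show ?thesis by (intro gen_mono[OF Suc.IH]) auto
  next
    case True
    define u where "u = X ! i"
    define v where "v = (\<lambda>b. reply u (snd (sweep X (init_regs b) i)))"
    have v: "adds n ?F 1 v"
    proof (cases "\<exists>f. basic_of u = Some (BI f MGet)")
      case True
      then obtain f where "basic_of u = Some (BI f MGet)" by auto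
      then have "v = rg i f" by (simp add: v_def reply_def rg_def)
      then have "v \<in> ?F" by simp
      from adds_mono[OF adds_mem[OF this]] show ?thesis by simp
    next
      case False
      then have "\<exists>b. v = (\<lambda>_. b)"
      proof (cases "basic_of u")
        case (Some a)
        with False obtain f b where "a = BI f (MSet b)" by (metis basic.exhaust meth.exhaust)
        with Some show ?thesis by (auto simp: v_def reply_def)
      qed (auto simp: v_def reply_def)
      then show ?thesis using adds_const by auto
    qed
    have pc: "pc (Suc i) j = (\<lambda>w. pc i j w \<or> pc i (Suc i) w \<and> next_pos u (v w) (Suc i) j)"
      if "Suc i < j" for j
      using sweep_pc[OF True that] by (auto simp: pc_def u_def v_def)
    have adds_pc: "adds n ?F 4 (pc (Suc i) j)" if "Suc i < j" for j
    proof -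
      have "adds n ?F (Suc (0 + Suc (0 + 2))) (pc (Suc i) j)"
        unfolding pc[OF that] using that
        by (intro adds_or adds_and adds_mem adds_unary[OF v]) auto
      then show ?thesis by (simp add: eval_nat_numeral)
    qed
    \<comment> \<open>The possible successors: the next position, the one after a skip, and a jump
      target. The third entry always exceeds \<open>Suc i\<close>, also for \<open>Jump 0\<close>
      and for instructions that do not jump, so that it can be treated like the other two.\<close>
    define J where "J = {Suc i + 1, Suc i + 2, Suc i + (case u of Jump l \<Rightarrow> max 1 l | _ \<Rightarrow> 1)}"
    have pc_old: "pc (Suc i) j = pc i j" if "Suc i < j" "j \<notin> J" for j
      unfolding pc[OF that(1)] using that(2)
      by (auto simp: J_def next_pos_def split: prim.splits if_splits)
    \<comment> \<open>The only register that this instruction can change; \<open>FOut\<close> is a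
      dummy for instructions that contain no basic instruction.\<close>
    define f0 where "f0 = (case basic_of u of Some (BI f m) \<Rightarrow> f | None \<Rightarrow> FOut)"
    have rg: "rg (Suc i) f = (\<lambda>b. if pc i (Suc i) b
        then effect u (snd (sweep X (init_regs b) i)) f else rg i f b)" for f
      using sweep_reg[OF True] by (auto simp: rg_def pc_def u_def)
    have rg_old: "rg (Suc i) f = rg i f" if "f \<noteq> f0" for f
    proof -
      have "effect u r f = r f" for r
      proof (cases "basic_of u")
        case (Some a)
        then show ?thesis using that
          by (cases a; cases "case a of BI f m \<Rightarrow> m") (auto simp: effect_def f0_def)
      qed (simp add: effect_def)
      then show ?thesis unfolding rg by (simp add: rg_def)
    qed
    have adds_rg: "adds n ?F 4 (rg (Suc i) f0)"
    proof (cases "\<exists>f b. basic_of u = Some (BI f (MSet b))")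
      case True
      then obtain b where b: "basic_of u = Some (BI f0 (MSet b))" by (auto simp: f0_def)
      then have eff: "effect u r f0 = b" for r by (simp add: effect_def)
      have at: "adds n ?F 0 (pc i (Suc i))" and old: "adds n ?F 0 (rg i f0)"
        by (auto intro!: adds_mem)
      show ?thesis
      proof (cases b)
        case True
        then have "rg (Suc i) f0 = (\<lambda>b. pc i (Suc i) b \<or> rg i f0 b)"
          unfolding rg eff by auto
        with adds_mono[OF adds_or[OF at old]] show ?thesis by simp
      next
        case False
        then have "rg (Suc i) f0 = (\<lambda>b. \<not> pc i (Suc i) b \<and> rg i f0 b)"
          unfolding rg eff by auto
        with adds_mono[OF adds_and[OF adds_not[OF at] old]] show ?thesis by simp
      qed
    next
      case False
      have "effect u r f0 = r f0" for r
      proof (cases "basic_of u")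
        case (Some a)
        with False obtain f where "a = BI f MGet" by (metis basic.exhaust meth.exhaust)
        with Some show ?thesis by (simp add: effect_def)
      qed (simp add: effect_def)
      then have "rg (Suc i) f0 = rg i f0" unfolding rg by (simp add: rg_def)
      then have "rg (Suc i) f0 \<in> ?F" by simp
      from adds_mono[OF adds_mem[OF this]] show ?thesis by simp
    qed
    let ?l = "Suc i + (case u of Jump l \<Rightarrow> max 1 l | _ \<Rightarrow> 1)"
    have l: "Suc i < ?l" by (auto split: prim.splits)
    have "gen n (n + 2 + 16 * i + 4) (insert (rg (Suc i) f0) ?F)"
      by (rule addsD[OF adds_rg Suc.IH]) auto
    from addsD[OF adds_pc this, of "Suc i + 1"]
    have "gen n (n + 2 + 16 * i + 4 + 4) (insert (pc (Suc i) (Suc i + 1)) (insert (rg (Suc i) f0) ?F))"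
      by auto
    from addsD[OF adds_pc this, of "Suc i + 2"]
    have "gen n (n + 2 + 16 * i + 4 + 4 + 4) (insert (pc (Suc i) (Suc i + 2))
        (insert (pc (Suc i) (Suc i + 1)) (insert (rg (Suc i) f0) ?F)))"
      by auto
    from addsD[OF adds_pc[OF l] this]
    have *: "gen n (n + 2 + 16 * i + 4 + 4 + 4 + 4) (insert (pc (Suc i) ?l)
        (insert (pc (Suc i) (Suc i + 2)) (insert (pc (Suc i) (Suc i + 1))
        (insert (rg (Suc i) f0) ?F))))" (is "gen _ _ ?E")
      by auto
    have "?F' \<subseteq> ?E"
    proof
      fix g assume "g \<in> ?F'"
      then consider j where "Suc i < j" "g = pc (Suc i) j" | f where "g = rg (Suc i) f" by auto
      then show "g \<in> ?E"
      proof cases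
        case 1
        show ?thesis
        proof (cases "j \<in> J")
          case True
          then show ?thesis using 1 by (auto simp: J_def)
        next
          case False
          then have "g = pc i j" using pc_old 1 by simp
          moreover have "i < j" using 1 by simp
          ultimately have "g \<in> ?F" by auto
          then show ?thesis by simp
        qed
      next
        case 2
        then show ?thesis using rg_old[of f] by (cases "f = f0") auto
      qed
    qed
    then show ?thesis by (intro gen_mono[OF *]) auto
  qed
qed

lemma is_computes_imp_circuit:
  assumes "is_computes X n f"
  shows "\<exists>C. circuit_wf n C \<and> length C \<le> n + 3 + 16 * length X \<and>
    (\<forall>w. length w = n \<longrightarrow> circuit_out C w = f w)"
proof -
  have "gen n (n + 2 + 16 * length X) {\<lambda>b. snd (sweep X (init_regs b) (length X)) FOut}"
    by (rule gen_mono[OF sweep_gen[of n "length X" X]]) auto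
  from gen_circuit[OF this] obtain C where C: "circuit_wf n C" "length C \<le> n + 3 + 16 * length X"
    "\<And>w. length w = n \<Longrightarrow> circuit_out C w = snd (sweep X (init_regs w) (length X)) FOut"
    by (auto simp: eval_nat_numeral)
  moreover have "snd (sweep X (init_regs w) (length X)) FOut = f w" if "length w = n" for w
  proof -
    obtain m i r where "is_config X (init_regs w) m = Some (i, r)" "is_step X i r = Terminated"
      "r FOut = f w"
      using assms \<open>length w = n\<close> unfolding is_computes_def by auto
    then show ?thesis by (simp add: sweep_terminated)
  qed
  ultimately show ?thesis by (intro exI[of _ C]) simp
qed

lemma P_lis_iff_pfam: "f \<in> P_lis \<longleftrightarrow> pfam (\<lambda>n (_ :: unit). f n)"
proof
  assume "f \<in> P_lis"
  then obtain h :: "real poly" where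
    h: "\<forall>n. \<exists>X. is_computes X n (f n) \<and> real (length X) \<le> poly h (real n)"
    unfolding P_lis_def by auto
  obtain c where c: "\<forall>n. poly h (real n) \<le> real ((n + 2) ^ c)" using poly_le_power by blast
  have "\<exists>C. circuit_wf n C \<and> length C \<le> (n + 2) ^ (2 + (c + 4) + 2) \<and>
    (\<forall>w. length w = n \<longrightarrow> circuit_out C w = f n w)" for n
  proof -
    obtain X where X: "is_computes X n (f n)" "real (length X) \<le> poly h (real n)" using h by blast
    then have "real (length X) \<le> real ((n + 2) ^ c)" using c order_trans by blast
    then have "length X \<le> (n + 2) ^ c" by (simp only: of_nat_le_iff)
    then have "2 ^ 4 * length X \<le> (n + 2) ^ 4 * (n + 2) ^ c"
      by (intro mult_le_mono power_mono) auto
    also have "\<dots> = (n + 2) ^ (c + 4)" by (simp only: power_add mult.commute)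
    finally have "16 * length X \<le> (n + 2) ^ (c + 4)" by simp
    moreover have "n + 3 \<le> (n + 2) ^ 2" by (simp add: power2_eq_square)
    ultimately have "n + 3 + 16 * length X \<le> (n + 2) ^ (2 + (c + 4) + 2)"
      using power_plus_power_le[of n 2 "c + 4"] by linarith
    moreover obtain C where "circuit_wf n C" "length C \<le> n + 3 + 16 * length X"
      "\<forall>w. length w = n \<longrightarrow> circuit_out C w = f n w"
      using is_computes_imp_circuit[OF X(1)] by auto
    ultimately show ?thesis by (intro exI[of _ C]) auto
  qed
  then show "pfam (\<lambda>n (_ :: unit). f n)" by (intro circuits_imp_pfam allI)
next
  assume "pfam (\<lambda>n (_ :: unit). f n)"
  from pfam_imp_circuits[OF this] obtain c where c: "\<forall>n. \<exists>C. circuit_wf n C \<and>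
      length C \<le> (n + 2) ^ c \<and> (\<forall>w. length w = n \<longrightarrow> circuit_out C w = f n w)" ..
  have "\<exists>X. is_computes X n (f n) \<and> real (length X) \<le> poly ([:2, 1:] ^ ((c + 2) + 2 + 2)) (real n)"
    for n
  proof -
    obtain C where C: "circuit_wf n C" "length C \<le> (n + 2) ^ c"
      "\<forall>w. length w = n \<longrightarrow> circuit_out C w = f n w" using c by blast
    obtain X where X: "is_computes X n (circuit_out C)" "length X \<le> 4 * length C + 3"
      using circuit_imp_is_computes[OF C(1)] by blast
    have "is_computes X n (f n)" using X(1) C(3) unfolding is_computes_def by simp
    moreover have "4 * length C \<le> (n + 2) ^ (c + 2)"
    proof -
      have "2 ^ 2 * length C \<le> (n + 2) ^ 2 * (n + 2) ^ c"
        by (intro mult_le_mono power_mono C) auto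
      also have "\<dots> = (n + 2) ^ (c + 2)" by (simp only: power_add mult.commute)
      finally show ?thesis by simp
    qed
    moreover have "3 \<le> (n + 2) ^ 2" by (simp add: power2_eq_square)
    ultimately have "is_computes X n (f n)" "length X \<le> (n + 2) ^ ((c + 2) + 2 + 2)"
      using power_plus_power_le[of n "c + 2" 2] X(2) by linarith+
    then show ?thesis by (intro exI[of _ X]) (simp only: power_as_poly[symmetric] of_nat_le_iff simp_thms)
  qed
  then have "\<forall>n. \<exists>X. is_computes X n (f n) \<and>
      real (length X) \<le> poly ([:2, 1:] ^ ((c + 2) + 2 + 2)) (real n)" ..
  then show "f \<in> P_lis" unfolding P_lis_def mem_Collect_eq ..
qed

section \<open>From 3SAT to its clause-indexed form\<close>

lemma dd_less: "dd k < dd (Suc k)"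
proof -
  have "(2 * k choose j) \<le> (2 * Suc k choose j)" for j
    by (rule binomial_right_mono) simp
  from this[of 2] this[of 3] show ?thesis by (simp add: dd_def)
qed

lemma dd_strict_mono: "strict_mono dd"
  by (simp add: strict_mono_Suc_iff dd_less)

lemma dd_0 [simp]: "dd 0 = 0"
  by (simp add: dd_def)

lemma le_dd: "k \<le> dd k"
  by (rule strict_mono_imp_increasing[OF dd_strict_mono])

lemma kk_eqI:
  assumes "dd k \<le> n" "n < dd (Suc k)"
  shows "kk n = k"
  unfolding kk_def
proof (rule the_equality)
  fix k' assume k': "dd k' \<le> n \<and> n < dd (Suc k')"
  then have "dd k' < dd (Suc k)" "dd k < dd (Suc k')" using assms by simp_all
  then have "k' < Suc k" "k < Suc k'" using strict_mono_less[OF dd_strict_mono] by blast+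
  then show "k' = k" by simp
qed (use assms in simp)

lemma kk_dd: "kk (dd k) = k"
  by (rule kk_eqI) (simp_all add: dd_less)

text \<open>The definite description in \<open>kk\<close> is met by the greatest \<open>k\<close>
  with \<open>dd k\<close> at most \<open>n\<close>; it exists because \<open>k\<close> is at most
  \<open>dd k\<close>.\<close>

lemma dd_kk_le: "dd (kk n) \<le> n"
proof -
  define k where "k = (GREATEST k. dd k \<le> n)"
  have bound: "k \<le> n" if "dd k \<le> n" for k
    using le_dd that by (rule le_trans)
  have 1: "dd k \<le> n" unfolding k_def by (rule GreatestI_nat[of _ 0 n]) (simp_all add: bound)
  have "\<not> dd (Suc k) \<le> n"
  proof
    assume "dd (Suc k) \<le> n"
    from Greatest_le_nat[of "\<lambda>k. dd k \<le> n", OF this bound] show False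
      by (simp add: k_def)
  qed
  with 1 show ?thesis using kk_eqI[of k n] by simp
qed

text \<open>As 2n is at most the square of m = n + 2, each binomial coefficient is at most the sixth
  power of m; the factor 3 for the three summands is at most the square of m.\<close>

lemma dd_le_power: "dd n \<le> (n + 2) ^ 8"
proof -
  let ?m = "n + 2"
  have *: "(2 * n choose j) \<le> ?m ^ 6" if "j \<le> 3" for j
  proof (cases "j \<le> 2 * n")
    case True
    have "(2 * n choose j) \<le> (2 * n) ^ j" using True by (rule binomial_le_pow)
    also have "\<dots> \<le> (?m ^ 2) ^ j" by (intro power_mono) (simp_all add: power2_eq_square)
    also have "\<dots> \<le> (?m ^ 2) ^ 3" by (intro power_increasing that) simp
    finally show ?thesis by (simp only: power_mult[symmetric]) simp
  qed (simp add: binomial_eq_0)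
  have "dd n \<le> ?m ^ 6 + ?m ^ 6 + ?m ^ 6"
    unfolding dd_def by (intro add_mono *) simp_all
  also have "\<dots> \<le> ?m ^ 2 * ?m ^ 6"
  proof -
    have "3 * ?m ^ 6 \<le> ?m ^ 2 * ?m ^ 6" by (rule mult_right_mono) (simp_all add: power2_eq_square)
    then show ?thesis by linarith
  qed
  also have "\<dots> = ?m ^ 8" by (simp only: power_add[symmetric]) simp
  finally show ?thesis .
qed

section \<open>Unique readability of the encoding\<close>

text \<open>Cutting at the first marker recovers the first piece. This serves two levels of the
  encoding: literals ended by \<open>SSep\<close> and clauses ended by \<open>SEnd\<close>.\<close>

lemma concat_map_terminated_inj:
  assumes "concat (map (\<lambda>x. g x @ [m]) xs) = concat (map (\<lambda>x. g x @ [m]) ys)"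
    and "\<And>x. m \<notin> set (g x)" and "inj g"
  shows "xs = ys"
  using assms(1)
proof (induction xs arbitrary: ys)
  case Nil
  then show ?case by (cases ys) auto
next
  case (Cons x xs)
  then obtain y ys' where ys: "ys = y # ys'" by (cases ys) auto
  let ?c = "\<lambda>zs. concat (map (\<lambda>x. g x @ [m]) zs)"
  have eq: "g x @ m # ?c xs = g y @ m # ?c ys'" using Cons.prems ys by simp
  have split: "takeWhile (\<lambda>z. z \<noteq> m) (g z @ m # r) = g z"
    "dropWhile (\<lambda>z. z \<noteq> m) (g z @ m # r) = m # r" for z r
    using assms(2) by (simp_all add: takeWhile_append dropWhile_append)
  have "g x = g y" using arg_cong[OF eq, of "takeWhile (\<lambda>z. z \<noteq> m)"] unfolding split .
  moreover have "?c xs = ?c ys'"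
    using arg_cong[OF eq, of "dropWhile (\<lambda>z. z \<noteq> m)"] unfolding split by simp
  ultimately show ?case using assms(3) Cons.IH ys by (auto dest: injD)
qed

lemma length_sym_bits [simp]: "length (sym_bits s) = 3"
  by (cases s) auto

lemma sym_bits_inj: "sym_bits s = sym_bits t \<Longrightarrow> s = t"
  by (cases s; cases t) auto

lemma length_to_bits [simp]: "length (to_bits s) = 3 * length s"
  unfolding to_bits_def by (induction s) auto

lemma to_bits_inj: "to_bits s = to_bits t \<Longrightarrow> s = t"
proof (induction s arbitrary: t)
  case Nil
  then show ?case by (cases t) (auto simp: to_bits_def dest: arg_cong[where f = length])
next
  case (Cons a s)
  then obtain b t' where "t = b # t'"
    by (cases t) (auto simp: to_bits_def dest: arg_cong[where f = length])
  with Cons show ?case by (auto simp: to_bits_def dest: sym_bits_inj)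
qed

lemma bin_pos: "0 < n \<Longrightarrow> bin n = bin (n div 2) @ [odd n]"
  by (cases n) simp_all


text \<open>The value of a binary numeral, most significant bit first: a left inverse of
  \<open>bin\<close> that is also defined on lists with leading zeros.\<close>

definition bits_val :: "bool list \<Rightarrow> nat" where
  "bits_val = foldl (\<lambda>x b. 2 * x + of_bool b) 0"

lemma bits_val_simps [simp]:
  "bits_val [] = 0" "bits_val (xs @ [b]) = 2 * bits_val xs + of_bool b"
  by (simp_all add: bits_val_def)

lemma bits_val_bin [simp]: "bits_val (bin n) = n"
proof (induction n rule: less_induct)
  case (less n)
  show ?case
  proof (cases "n = 0")
    case False
    then have "bits_val (bin n) = 2 * (n div 2) + of_bool (odd n)"
      using less[of "n div 2"] by (simp add: bin_pos)
    then show ?thesis by (cases "even n") auto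
  qed simp
qed

lemma bin_inj: "bin m = bin n \<Longrightarrow> m = n"
  by (metis bits_val_bin)

lemma length_bin: "2 ^ d \<le> n \<Longrightarrow> n < 2 ^ Suc d \<Longrightarrow> length (bin n) = Suc d"
proof (induction d arbitrary: n)
  case 0
  then have "n = 1" by simp
  then show ?case by (simp add: bin_pos)
next
  case (Suc d)
  have "2 ^ d \<le> n div 2" "n div 2 < 2 ^ Suc d" using Suc.prems by auto
  from Suc.IH[OF this] Suc.prems show ?case by (subst bin_pos) (auto intro: Suc_le_lessD le_trans[rotated])
qed

lemma enc_lit_inj: "inj enc_lit"
proof (rule injI)
  have inj: "map (\<lambda>b. if b then S1 else S0) xs = map (\<lambda>b. if b then S1 else S0) ys \<Longrightarrow> xs = ys" for xs ys
    by (rule map_injective) (auto intro: injI split: if_splits)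
  have ne: "SNeg # xs \<noteq> map (\<lambda>b. if b then S1 else S0) ys" for xs ys
    by (cases ys) auto
  fix l l' assume "enc_lit l = enc_lit l'"
  then show "l = l'"
    by (cases l; cases l') (auto dest!: inj bin_inj simp: ne ne[symmetric])
qed

lemma enc_formula_inj:
  assumes "enc_formula \<phi> = enc_formula \<psi>"
  shows "\<phi> = \<psi>"
proof -
  let ?g = "\<lambda>c. concat (map (\<lambda>l. enc_lit l @ [SSep]) c)"
  have lit: "SSep \<notin> set (enc_lit l)" "SEnd \<notin> set (enc_lit l)" for l
    by (cases l; auto split: if_splits)+
  have "inj ?g"
    by (rule injI) (erule concat_map_terminated_inj[OF _ lit(1) enc_lit_inj])
  moreover have "concat (map (\<lambda>c. ?g c @ [SEnd]) \<phi>) = concat (map (\<lambda>c. ?g c @ [SEnd]) \<psi>)"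
  proof -
    have "enc_clause = (\<lambda>c. ?g c @ [SEnd])" by (simp add: enc_clause_def fun_eq_iff)
    with to_bits_inj[OF assms[unfolded enc_formula_def]] show ?thesis by simp
  qed
  ultimately show ?thesis
    by (intro concat_map_terminated_inj[of ?g SEnd]) (auto simp: lit)
qed

lemma enc_formula_in_ThreeSAT_iff:
  "is_3cnf \<phi> \<Longrightarrow> enc_formula \<phi> \<in> ThreeSAT \<longleftrightarrow> cnf_sat \<phi>"
  unfolding ThreeSAT_def by (auto dest: enc_formula_inj)


section \<open>Switching clauses on and off at constant length\<close>

text \<open>Switching a clause off must not change the length of the encoding.  So variable \<open>v\<close> is
  renamed to \<open>2 ^ v\<close>, and a switched-off literal becomes a positive literal of a variable
  \<open>2 ^ m - 1\<close> with an encoding of the same length.\<close>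

fun on_lit :: "lit \<Rightarrow> lit" where
  "on_lit (Pos v) = Pos (2 ^ v)"
| "on_lit (Neg v) = Neg (2 ^ v)"

fun off_lit :: "lit \<Rightarrow> lit" where
  "off_lit (Pos v) = Pos (2 ^ Suc v - 1)"
| "off_lit (Neg v) = Pos (2 ^ Suc (Suc v) - 1)"

lemma length_bin_power: "length (bin (2 ^ v)) = Suc v"
  by (rule length_bin) simp_all

lemma length_bin_ones: "length (bin (2 ^ Suc v - 1)) = Suc v"
proof (rule length_bin)
  have "(1 :: nat) \<le> 2 ^ v" by simp
  then show "2 ^ v \<le> (2 ^ Suc v - 1 :: nat)" by simp
qed simp

lemma length_enc_on_lit: "length (enc_lit (on_lit l)) \<le> lit_var l + 2"
  by (cases l) (simp_all add: length_bin_power)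

text \<open>Both \<open>2 ^ v\<close> and \<open>2 ^ Suc v - 1\<close> have \<open>v + 1\<close>
  binary digits. A negative literal gets one digit more when switched off, in exchange for the lost
  symbol \<open>SNeg\<close>.\<close>

lemma length_enc_off_lit: "length (enc_lit (off_lit l)) = length (enc_lit (on_lit l))"
  using length_bin_ones by (cases l) (simp_all add: length_bin_power del: power_Suc)

lemma length_enc_clause: "length (enc_clause c) = (\<Sum>l\<leftarrow>c. length (enc_lit l) + 1) + 1"
  by (simp add: enc_clause_def length_concat o_def)

lemma length_enc_clause_off:
  "length (enc_clause (map off_lit c)) = length (enc_clause (map on_lit c))"
  by (simp add: length_enc_clause length_enc_off_lit o_def)

lemma lit_var_on_off: "1 \<le> lit_var (on_lit l)" "1 \<le> lit_var (off_lit l)"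
proof -
  have "(1 :: nat) \<le> 2 ^ v" for v by simp
  then have "(2 :: nat) \<le> 2 ^ Suc v" for v by (metis mult_le_mono2 mult_1_right power_Suc)
  then have "(1 :: nat) \<le> 2 ^ Suc v - 1" for v by (metis diff_le_mono diff_add_inverse2 one_add_one)
  then show "1 \<le> lit_var (on_lit l)" "1 \<le> lit_var (off_lit l)"
    by (cases l; simp del: power_Suc; fail)+
qed

definition switch_formula :: "(nat \<Rightarrow> lit list) \<Rightarrow> nat \<Rightarrow> bool list \<Rightarrow> lit list list" where
  "switch_formula cs D b = map (\<lambda>i. map (if b ! i then on_lit else off_lit) (cs i)) [0..<D]"

text \<open>The left side is odd and larger than 1, while 1 is the only odd power of two. Thus
  variables of switched-off literals never clash with renamed ones.\<close>

lemma ones_neq_power: "1 \<le> v \<Longrightarrow> (2 ^ Suc v - 1 :: nat) \<noteq> 2 ^ u"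
proof
  assume v: "1 \<le> v" and eq: "(2 ^ Suc v - 1 :: nat) = 2 ^ u"
  have "odd (2 ^ Suc v - 1 :: nat)" by simp
  then have "u = 0" unfolding eq by (cases u) auto
  moreover have "(2 :: nat) ^ 1 \<le> 2 ^ v" by (rule power_increasing[OF v]) simp
  ultimately show False using eq by simp
qed

lemma cnf_sat_switch_formula:
  assumes "\<And>i l. i < D \<Longrightarrow> l \<in> set (cs i) \<Longrightarrow> 1 \<le> lit_var l" "\<And>i. i < D \<Longrightarrow> cs i \<noteq> []"
  shows "cnf_sat (switch_formula cs D b) \<longleftrightarrow>
    (\<exists>\<sigma>. \<forall>i<D. b ! i \<longrightarrow> (\<exists>l\<in>set (cs i). lit_val \<sigma> l))"
proof
  assume "cnf_sat (switch_formula cs D b)"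
  then obtain \<sigma> where \<sigma>: "\<forall>i\<in>{0..<D}. \<exists>l\<in>set (cs i). lit_val \<sigma> ((if b ! i then on_lit else off_lit) l)"
    unfolding cnf_sat_def switch_formula_def by auto
  have *: "lit_val \<sigma> (on_lit l) = lit_val (\<lambda>v. \<sigma> (2 ^ v)) l" for l by (cases l) auto
  have "\<forall>i<D. b ! i \<longrightarrow> (\<exists>l\<in>set (cs i). lit_val (\<lambda>v. \<sigma> (2 ^ v)) l)"
    unfolding *[symmetric]
  proof (intro allI impI)
    fix i assume "i < D" "b ! i"
    with bspec[OF \<sigma>, of i] show "\<exists>l\<in>set (cs i). lit_val \<sigma> (on_lit l)" by simp
  qed
  then show "\<exists>\<sigma>. \<forall>i<D. b ! i \<longrightarrow> (\<exists>l\<in>set (cs i). lit_val \<sigma> l)"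
    by (rule exI[of _ "\<lambda>v. \<sigma> (2 ^ v)"])
next
  assume "\<exists>\<sigma>. \<forall>i<D. b ! i \<longrightarrow> (\<exists>l\<in>set (cs i). lit_val \<sigma> l)"
  then obtain \<sigma> where \<sigma>: "\<forall>i<D. b ! i \<longrightarrow> (\<exists>l\<in>set (cs i). lit_val \<sigma> l)" ..
  \<comment> \<open>At \<open>2 ^ v\<close> the exponent is unique, so the value is that of
    \<open>v\<close>. At any other number the condition is vacuous and the value is True, which
    satisfies all switched-off literals.\<close>
  define \<tau> where "\<tau> = (\<lambda>x :: nat. \<forall>v. x = 2 ^ v \<longrightarrow> \<sigma> v)"
  have on: "lit_val \<tau> (on_lit l) = lit_val \<sigma> l" for l
    by (cases l) (auto simp: \<tau>_def)
  have ones: "\<tau> (2 ^ Suc v - 1)" if "1 \<le> v" for v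
    using ones_neq_power[OF that] unfolding \<tau>_def by blast
  have off: "lit_val \<tau> (off_lit l)" if "1 \<le> lit_var l" for l
    using that ones by (cases l) (simp_all del: power_Suc)
  have "\<exists>l\<in>set (cs i). lit_val \<tau> ((if b ! i then on_lit else off_lit) l)" if i: "i < D" for i
  proof (cases "b ! i")
    case True
    then show ?thesis using \<sigma> i by (simp add: on)
  next
    case False
    obtain l where l: "l \<in> set (cs i)" using assms(2)[OF i] by (cases "cs i") auto
    then show ?thesis using off[OF assms(1)[OF i l]] False by auto
  qed
  then show "cnf_sat (switch_formula cs D b)"
    unfolding cnf_sat_def switch_formula_def by (intro exI[of _ \<tau>]) auto
qed

lemma enc_formula_concat: "enc_formula \<phi> = concat (map (\<lambda>c. to_bits (enc_clause c)) \<phi>)"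
  by (induction \<phi>) (simp_all add: enc_formula_def to_bits_def)

text \<open>Both variants of a block have the same length, so which block contains position
  \<open>j\<close>, and at which offset, does not depend on \<open>b\<close>.\<close>

lemma concat_switch_nth:
  assumes "\<And>i. i < D \<Longrightarrow> length (A i) = length (B i)"
    and "j < length (concat (map (\<lambda>i. B i) [0..<D]))"
  shows "\<exists>i<D. \<exists>x y. \<forall>b. concat (map (\<lambda>i. if b ! i then A i else B i) [0..<D]) ! j = (if b ! i then x else y)"
  using assms
proof (induction D)
  case 0
  then show ?case by simp
next
  case (Suc D)
  let ?c = "\<lambda>D b. concat (map (\<lambda>i. if b ! i then A i else B i) [0..<D])"
  let ?L = "length (concat (map (\<lambda>i. B i) [0..<D]))"
  have len: "length (?c D b) = ?L" for b :: "bool list"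
    unfolding length_concat map_map o_def
    by (rule arg_cong[where f = sum_list]) (use Suc.prems(1) in auto)
  have c: "?c (Suc D) b = ?c D b @ (if b ! D then A D else B D)" for b :: "bool list" by simp
  show ?case
  proof (cases "j < ?L")
    case True
    then obtain i x y where "i < D" "\<forall>b. ?c D b ! j = (if b ! i then x else y)"
      using Suc by auto
    then have "\<forall>b. ?c (Suc D) b ! j = (if b ! i then x else y)"
      unfolding c nth_append len using True by simp
    with \<open>i < D\<close> show ?thesis by (metis less_Suc_eq)
  next
    case False
    have "\<forall>b. ?c (Suc D) b ! j = (if b ! D then A D ! (j - ?L) else B D ! (j - ?L))"
      unfolding c nth_append len using False by simp
    then show ?thesis by (metis lessI)
  qed
qed

lemma ThreeSAT_imp_ThreeSATC:
  assumes bij: "\<And>k. bij_betw (\<alpha> k) {1..dd k} (Lk k)"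
    and sat: "pfam (\<lambda>n (_ :: unit) w. w \<in> ThreeSAT)"
  shows "pfam (\<lambda>n (_ :: unit). ThreeSATC \<alpha> n)"
proof -
  have ex: "\<exists>c. set c = \<alpha> k (Suc i) \<and> length c = card (\<alpha> k (Suc i))" if "i < dd k" for k i
  proof -
    have "\<alpha> k (Suc i) \<in> Lk k" using bij_betwE[OF bij, of k] that by simp
    then have "finite (\<alpha> k (Suc i))" unfolding Lk_def by (auto intro: card_ge_0_finite)
    then show ?thesis using finite_distinct_list distinct_card by metis
  qed
  \<comment> \<open>An enumeration without repetitions: a list whose length is the cardinality of
    the clause respects the limit of three literals.\<close>
  define cs where "cs = (\<lambda>k i. SOME c. set c = \<alpha> k (Suc i) \<and> length c = card (\<alpha> k (Suc i)))"
  have cs: "set (cs k i) = \<alpha> k (Suc i)" "length (cs k i) = card (\<alpha> k (Suc i))"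
    if "i < dd k" for k i
    using someI_ex[OF ex[OF that]] unfolding cs_def by auto
  have Lk: "set (cs k i) \<in> Lk k" if "i < dd k" for k i
    using bij_betwE[OF bij, of k] that by (simp add: cs(1))
  have cs_len: "1 \<le> length (cs k i)" "length (cs k i) \<le> 3" if "i < dd k" for k i
    using Lk[OF that] cs[OF that] unfolding Lk_def by auto
  have cs_var: "1 \<le> lit_var l" "lit_var l \<le> k" if "i < dd k" "l \<in> set (cs k i)" for k i l
    using Lk[OF that(1)] that(2) unfolding Lk_def lits_def by auto
  define \<phi> where "\<phi> = (\<lambda>n b. switch_formula (cs (kk n)) (dd (kk n)) b)"
  have cnf: "is_3cnf (\<phi> n b)" for n b
    using cs_len lit_var_on_off unfolding is_3cnf_def \<phi>_def switch_formula_def by auto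
  have correct: "enc_formula (\<phi> n b) \<in> ThreeSAT \<longleftrightarrow> ThreeSATC \<alpha> n b" for n b
  proof -
    have "{1..dd (kk n)} = Suc ` {..<dd (kk n)}"
      by (simp add: lessThan_atLeast0 image_Suc_atLeastLessThan atLeastLessThanSuc_atLeastAtMost)
    then have range: "(\<forall>i\<in>{1..dd (kk n)}. P i) \<longleftrightarrow> (\<forall>i<dd (kk n). P (Suc i))" for P by auto
    have "ThreeSATC \<alpha> n b \<longleftrightarrow>
        (\<exists>\<sigma>. \<forall>i<dd (kk n). b ! i \<longrightarrow> (\<exists>l\<in>set (cs (kk n) i). lit_val \<sigma> l))"
      unfolding ThreeSATC_def range by (simp add: cs)
    also have "\<dots> \<longleftrightarrow> cnf_sat (\<phi> n b)"
      unfolding \<phi>_def using cs_var(1) cs_len(1) by (subst cnf_sat_switch_formula) fastforce+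
    finally show ?thesis using enc_formula_in_ThreeSAT_iff[OF cnf] by simp
  qed
  define A where "A = (\<lambda>n i. to_bits (enc_clause (map on_lit (cs (kk n) i))))"
  define B where "B = (\<lambda>n i. to_bits (enc_clause (map off_lit (cs (kk n) i))))"
  have AB: "length (A n i) = length (B n i)" for n i
    by (simp add: A_def B_def length_enc_clause_off)
  have enc: "enc_formula (\<phi> n b) = concat (map (\<lambda>i. if b ! i then A n i else B n i) [0..<dd (kk n)])"
    for n b
    unfolding enc_formula_concat \<phi>_def switch_formula_def A_def B_def
    unfolding map_map o_def
    by (rule arg_cong[where f = concat]) auto
  define N where "N = (\<lambda>n. length (concat (map (B n) [0..<dd (kk n)])))"
  have len: "length (enc_formula (\<phi> n b)) = N n" for n b
    unfolding enc N_def by (simp add: length_concat o_def if_distrib AB cong: map_cong if_cong)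
  have N: "N n \<le> (n + 2) ^ 7" for n
  proof -
    \<comment> \<open>The renaming to \<open>2 ^ v\<close> makes binary numerals as long as unary
      ones. This is harmless because \<open>v\<close> is at most \<open>kk n\<close>, hence at most
      \<open>n\<close>. A clause then takes at most 3(n + 3) + 1 symbols of three bits each.\<close>
    have B: "length (B n i) \<le> 9 * n + 30" if "i < dd (kk n)" for i
    proof -
      have "(\<Sum>l\<leftarrow>cs (kk n) i. length (enc_lit (on_lit l)) + 1) \<le> (\<Sum>l\<leftarrow>cs (kk n) i. n + 3)"
      proof (rule sum_list_mono)
        fix l assume "l \<in> set (cs (kk n) i)"
        from cs_var(2)[OF that this] have "lit_var l \<le> n"
          using le_dd[of "kk n"] dd_kk_le[of n] by linarith
        then show "length (enc_lit (on_lit l)) + 1 \<le> n + 3"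
          using length_enc_on_lit[of l] by linarith
      qed
      also have "\<dots> = length (cs (kk n) i) * (n + 3)" by (simp add: sum_list_triv)
      also have "\<dots> \<le> 3 * (n + 3)" using cs_len(2)[OF that] by (intro mult_right_mono) auto
      finally have "length (enc_clause (map on_lit (cs (kk n) i))) \<le> 3 * (n + 3) + 1"
        by (simp add: length_enc_clause o_def)
      then show ?thesis by (simp add: B_def length_enc_clause_off)
    qed
    have "N n = (\<Sum>i\<leftarrow>[0..<dd (kk n)]. length (B n i))"
      by (simp add: N_def length_concat o_def)
    also have "\<dots> \<le> (\<Sum>i\<leftarrow>[0..<dd (kk n)]. 9 * n + 30)"
      by (rule sum_list_mono) (simp add: B)
    also have "\<dots> = dd (kk n) * (9 * n + 30)" by (simp add: sum_list_triv)
    also have "\<dots> \<le> (n + 2) ^ 1 * (2 ^ 5 * (n + 2) ^ 1)"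
      using dd_kk_le[of n] by (intro mult_le_mono) auto
    also have "\<dots> \<le> (n + 2) ^ 1 * ((n + 2) ^ 5 * (n + 2) ^ 1)"
      by (intro mult_le_mono power_mono) auto
    also have "\<dots> = (n + 2) ^ 7" by (simp only: power_add[symmetric]) simp
    finally show ?thesis .
  qed
  define g where "g = (\<lambda>n j b. j < N n \<and> enc_formula (\<phi> n b) ! j)"
  have "adds n {} ((n + 2) ^ 1) (g n j)" for n j
  proof (cases "j < N n")
    case True
    then obtain i x y where i: "i < dd (kk n)"
      and xy: "\<forall>b. enc_formula (\<phi> n b) ! j = (if b ! i then x else y)"
      using concat_switch_nth[of "dd (kk n)" "A n" "B n" j] AB unfolding N_def enc by auto
    have "adds n {} 2 (\<lambda>b. (\<lambda>z. if z then x else y) (b ! i))"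
      using i dd_kk_le[of n] by (intro adds_unary adds_input) linarith
    moreover have "g n j = (\<lambda>b. (\<lambda>z. if z then x else y) (b ! i))"
      using True xy by (simp add: g_def)
    ultimately have "adds n {} 2 (g n j)" by simp
    from adds_mono[OF this] show ?thesis by simp
  next
    case False
    then have "g n j = (\<lambda>_. False)" by (simp add: g_def)
    then show ?thesis using adds_mono[OF adds_const[of n "{}" False]] by simp
  qed
  then have "pfam g" unfolding pfam_def by (intro exI allI)
  from pfam_compose[OF sat this N]
  have "pfam (\<lambda>n (_ :: unit) b. map (\<lambda>j. g n j b) [0..<N n] \<in> ThreeSAT)" .
  moreover have "map (\<lambda>j. g n j b) [0..<N n] = enc_formula (\<phi> n b)" for n b
    by (rule nth_equalityI) (simp_all add: g_def len)
  ultimately show ?thesis by (simp add: correct)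
qed

section \<open>From the clause-indexed form to 3SAT\<close>

text \<open>As every symbol code has three bits, this fails automatically where the word has
  ended.\<close>

definition sym_at :: "bool list \<Rightarrow> nat \<Rightarrow> sym \<Rightarrow> bool" where
  "sym_at w p S \<longleftrightarrow> take 3 (drop (3 * p) w) = sym_bits S"

text \<open>Requiring the leading digit \<open>S1\<close> singles out the codes of positive numbers
  without leading zeros, so equal numbers have equal digit strings. The bound
  \<open>t < length w\<close> puts the quantifier into the form for which circuits are
  built.\<close>

definition num_at :: "bool list \<Rightarrow> nat \<Rightarrow> nat \<Rightarrow> bool" where
  "num_at w a e \<longleftrightarrow> a < e \<and> sym_at w a S1 \<and>
     (\<forall>t<length w. a < t \<and> t < e \<longrightarrow> sym_at w t S0 \<or> sym_at w t S1) \<and> sym_at w e SSep"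

text \<open>The list consists of triples \<open>(g, a, e)\<close>: a literal, positive iff \<open>g\<close>, whose variable index
  is written at the positions from \<open>a\<close> to \<open>e - 1\<close> and followed by a separator.  Positions count
  symbols, not bits.\<close>

fun clause_at :: "bool list \<Rightarrow> nat \<Rightarrow> (bool \<times> nat \<times> nat) list \<Rightarrow> bool" where
  "clause_at w p [] \<longleftrightarrow> sym_at w p SEnd"
| "clause_at w p ((g, a, e) # r) \<longleftrightarrow> (if g then a = p else a = Suc p \<and> sym_at w p SNeg) \<and>
     num_at w a e \<and> clause_at w (Suc e) r"

text \<open>In a well-formed word \<open>SEnd\<close> occurs only as the last symbol of a clause, so
  this local condition locates the starts of clauses, and the end of the word.\<close>

definition boundary :: "bool list \<Rightarrow> nat \<Rightarrow> bool" where
  "boundary w p \<longleftrightarrow> p = 0 \<or> sym_at w (p - 1) SEnd"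

text \<open>The candidate parses of a single clause. The limit of three literals keeps their number
  polynomial, so a circuit can try all of them.\<close>

definition chains :: "nat \<Rightarrow> (bool \<times> nat \<times> nat) list set" where
  "chains n = {r. set r \<subseteq> UNIV \<times> {..<n} \<times> {..<n} \<and> length r \<le> 3}"

text \<open>Instead of guessing a parse of the whole word, only the next clause is required to be
  readable from each boundary; reading it leads to the next boundary.\<close>

definition valid :: "bool list \<Rightarrow> bool" where
  "valid w \<longleftrightarrow> 3 dvd length w \<and> (\<forall>p<length w. 3 * p < length w \<longrightarrow> (\<exists>S\<in>UNIV. sym_at w p S)) \<and>
     (\<forall>p<length w. 3 * p < length w \<and> boundary w p \<longrightarrow>
        (\<exists>r\<in>chains (length w). r \<noteq> [] \<and> clause_at w p r))"

text \<open>The indices may be exponentially large, so they are compared digit by digit. The end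
  positions \<open>e\<close> and \<open>e'\<close> are determined by \<open>a\<close> and
  \<open>a'\<close>.\<close>

definition same_num :: "bool list \<Rightarrow> nat \<Rightarrow> nat \<Rightarrow> bool" where
  "same_num w a a' \<longleftrightarrow> (\<exists>e<length w. \<exists>e'<length w. num_at w a e \<and> num_at w a' e' \<and> e - a = e' - a' \<and>
     (\<forall>t<length w. t < e - a \<longrightarrow> (sym_at w (a + t) S1 \<longleftrightarrow> sym_at w (a' + t) S1)))"

text \<open>The occurrence is named after the position of its leading digit. The successor keeps
  variable indices between 1 and the length of the word.\<close>

fun occ :: "bool \<times> nat \<times> nat \<Rightarrow> lit" where
  "occ (g, a, e) = (if g then Pos (Suc a) else Neg (Suc a))"

text \<open>Clauses of the second kind say that the variable of one occurrence implies that of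
  another. Since \<open>same_num\<close> is symmetric, both directions are present and together
  express equality.\<close>

definition occ_clause :: "bool list \<Rightarrow> lit set \<Rightarrow> bool" where
  "occ_clause w L \<longleftrightarrow> (\<exists>p<length w. \<exists>r\<in>chains (length w). (r \<noteq> [] \<and> L = occ ` set r) \<and>
       boundary w p \<and> clause_at w p r) \<or>
     (\<exists>a<length w. \<exists>a'<length w. L = {Neg (Suc a), Pos (Suc a')} \<and> same_num w a a')"

section \<open>Polynomial circuits for the parsing predicates\<close>

lemma pfam_bex_less:
  fixes F :: "nat \<Rightarrow> 'x \<Rightarrow> nat \<Rightarrow> bool list \<Rightarrow> bool"
  assumes "pfam (\<lambda>n xy w. F n (fst xy) (snd xy) w)"
  shows "pfam (\<lambda>n x w. \<exists>y<length w. F n x y w)"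
  by (rule pfam_cong[OF pfam_bex[where e = 1 and I = "\<lambda>n x. {..<n}", OF assms]]) auto

lemma pfam_all_less:
  fixes F :: "nat \<Rightarrow> 'x \<Rightarrow> nat \<Rightarrow> bool list \<Rightarrow> bool"
  assumes "pfam (\<lambda>n xy w. F n (fst xy) (snd xy) w)"
  shows "pfam (\<lambda>n x w. \<forall>y<length w. F n x y w)"
  by (rule pfam_cong[OF pfam_ball[where e = 1 and I = "\<lambda>n x. {..<n}", OF assms]]) auto

text \<open>With m = n + 2, there are at most \<open>m ^ 3\<close> triples, hence at most
  \<open>m ^ 9\<close> lists of each length from 0 to 3; these four lengths contribute a factor of
  at most \<open>m ^ 2\<close>.\<close>

lemma chains_finite_card: "finite (chains n)" "card (chains n) \<le> (n + 2) ^ 11"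
proof -
  let ?A = "(UNIV :: bool set) \<times> {..<n} \<times> {..<n}" and ?m = "n + 2"
  have fin: "finite ?A" by simp
  show "finite (chains n)" unfolding chains_def by (rule finite_lists_length_le[OF fin])
  have "2 * (n * n) \<le> ?m * (?m * ?m)" by (intro mult_le_mono) auto
  then have A: "card ?A \<le> ?m ^ 3" by (simp add: card_cartesian_product eval_nat_numeral)
  have "card (chains n) = (\<Sum>i\<le>3. card ?A ^ i)"
    unfolding chains_def by (rule card_lists_length_le[OF fin])
  also have "\<dots> \<le> (\<Sum>i\<le>(3::nat). ?m ^ 9)"
  proof (rule sum_mono)
    fix i :: nat assume "i \<in> {..3}"
    have "card ?A ^ i \<le> (?m ^ 3) ^ i" by (rule power_mono[OF A]) simp
    also have "\<dots> \<le> (?m ^ 3) ^ 3" using \<open>i \<in> {..3}\<close> by (intro power_increasing) auto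
    finally show "card ?A ^ i \<le> ?m ^ 9" by (simp only: power_mult[symmetric]) simp
  qed
  also have "\<dots> = 2 ^ 2 * ?m ^ 9" by simp
  also have "\<dots> \<le> ?m ^ 2 * ?m ^ 9" by (intro mult_le_mono power_mono) auto
  also have "\<dots> = ?m ^ 11" by (simp only: power_add[symmetric]) simp
  finally show "card (chains n) \<le> ?m ^ 11" .
qed

lemma pfam_bex_chains:
  fixes F :: "nat \<Rightarrow> 'x \<Rightarrow> (bool \<times> nat \<times> nat) list \<Rightarrow> bool list \<Rightarrow> bool"
  assumes "pfam (\<lambda>n xy w. F n (fst xy) (snd xy) w)"
  shows "pfam (\<lambda>n x w. \<exists>y\<in>chains (length w). F n x y w)"
  by (rule pfam_cong[OF pfam_bex[where e = 11 and I = "\<lambda>n x. chains n", OF assms]])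
    (auto simp: chains_finite_card(1) intro: chains_finite_card(2)[simplified])

lemma pfam_length: "pfam (\<lambda>n x w. P n x (length w))"
  by (rule pfam_cong[OF pfam_const[of "\<lambda>n x. P n x n"]]) simp

lemma pfam_sym_at: "pfam (\<lambda>n x w. sym_at w (p n x) (S n x))"
proof -
  let ?q = "\<lambda>n x. 3 * p n x" and ?b = "\<lambda>n x. sym_bits (S n x)"
  have "pfam (\<lambda>n x w. ?q n x + 2 < n \<and>
      ((?q n x < n \<and> w ! ?q n x) \<longleftrightarrow> ?b n x ! 0) \<and>
      ((?q n x + 1 < n \<and> w ! (?q n x + 1)) \<longleftrightarrow> ?b n x ! 1) \<and>
      ((?q n x + 2 < n \<and> w ! (?q n x + 2)) \<longleftrightarrow> ?b n x ! 2))"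
    by (intro pfam_and pfam_iff pfam_input pfam_const)
  then show ?thesis
  proof (rule pfam_cong, goal_cases)
    case (1 n x w)
    let ?t = "take 3 (drop (?q n x) w)"
    have "?t = ?b n x \<longleftrightarrow> length ?t = 3 \<and> (\<forall>i<3. ?t ! i = ?b n x ! i)"
      by (auto simp: list_eq_iff_nth_eq)
    also have "length ?t = 3 \<longleftrightarrow> ?q n x + 2 < n" using 1 by auto
    also have "(\<forall>i<3. ?t ! i = ?b n x ! i) \<longleftrightarrow>
        ?t ! 0 = ?b n x ! 0 \<and> ?t ! 1 = ?b n x ! 1 \<and> ?t ! 2 = ?b n x ! 2"
      by (auto simp: eval_nat_numeral less_Suc_eq)
    finally show ?case using 1 unfolding sym_at_def by auto
  qed
qed

lemma pfam_num_at: "pfam (\<lambda>n x w. num_at w (a n x) (e n x))"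
  unfolding num_at_def
  by (intro pfam_and pfam_const pfam_sym_at pfam_all_less pfam_imp pfam_or)

lemma pfam_boundary: "pfam (\<lambda>n x w. boundary w (p n x))"
  unfolding boundary_def by (intro pfam_or pfam_const pfam_sym_at)

lemma pfam_same_num: "pfam (\<lambda>n x w. same_num w (a n x) (a' n x))"
  unfolding same_num_def
  by (intro pfam_bex_less pfam_and pfam_const pfam_num_at pfam_all_less pfam_imp pfam_iff pfam_sym_at)

text \<open>The recursion along the list is unfolded \<open>d\<close> times. The exponent grows with
  \<open>d\<close>, so the number of literals must be bounded by a constant. Both \<open>r\<close>
  and \<open>p\<close> vary in the induction, because the recursive call concerns the tail of the
  list and the position behind the separator.\<close>

lemma pfam_clause_at: "pfam (\<lambda>n x w. length (r n x) \<le> d \<and> clause_at w (p n x) (r n x))"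
proof (induction d arbitrary: r p)
  case 0
  have "pfam (\<lambda>n x w. r n x = [] \<and> sym_at w (p n x) SEnd)"
    by (intro pfam_and pfam_const pfam_sym_at)
  then show ?case by (rule pfam_cong) auto
next
  case (Suc d)
  let ?g = "\<lambda>n x. fst (hd (r n x))" and ?a = "\<lambda>n x. fst (snd (hd (r n x)))"
    and ?e = "\<lambda>n x. snd (snd (hd (r n x)))"
  have "pfam (\<lambda>n x w. (r n x = [] \<and> sym_at w (p n x) SEnd) \<or>
     (r n x \<noteq> [] \<and> ((?g n x \<and> ?a n x = p n x) \<or>
        ((\<not> ?g n x \<and> ?a n x = Suc (p n x)) \<and> sym_at w (p n x) SNeg)) \<and>
      num_at w (?a n x) (?e n x) \<and>
      (length (tl (r n x)) \<le> d \<and> clause_at w (Suc (?e n x)) (tl (r n x)))))"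
    by (intro pfam_or pfam_and pfam_const pfam_sym_at pfam_num_at Suc.IH)
  then show ?case
  proof (rule pfam_cong, goal_cases)
    case (1 n x w)
    show ?case
    proof (cases "r n x")
      case (Cons i r')
      then show ?thesis by (cases i) auto
    qed auto
  qed
qed

lemma pfam_bex_clause_at:
  fixes F :: "nat \<Rightarrow> 'x \<Rightarrow> (bool \<times> nat \<times> nat) list \<Rightarrow> bool list \<Rightarrow> bool"
  assumes "pfam (\<lambda>n xy w. F n (fst xy) (snd xy) w)"
  shows "pfam (\<lambda>n x w. \<exists>r\<in>chains (length w). F n x r w \<and> clause_at w (p n x) r)"
proof -
  have "pfam (\<lambda>n x w. \<exists>r\<in>chains (length w). F n x r w \<and> length r \<le> 3 \<and> clause_at w (p n x) r)"
    by (intro pfam_bex_chains pfam_and assms pfam_clause_at)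
  then show ?thesis by (rule pfam_cong) (auto simp: chains_def)
qed

lemma finite_UNIV_sym: "finite (UNIV :: sym set)" and card_UNIV_sym: "card (UNIV :: sym set) \<le> (n + 2) ^ 3"
proof -
  have U: "(UNIV :: sym set) = {S0, S1, SNeg, SSep, SEnd}" by (auto intro: sym.exhaust)
  show "finite (UNIV :: sym set)" unfolding U by simp
  have "card (UNIV :: sym set) \<le> 2 ^ 3" unfolding U by simp
  also have "\<dots> \<le> (n + 2) ^ 3" by (rule power_mono) auto
  finally show "card (UNIV :: sym set) \<le> (n + 2) ^ 3" .
qed

lemma pfam_valid: "pfam (\<lambda>n x w. valid w)"
  unfolding valid_def
  by (intro pfam_and pfam_length pfam_all_less pfam_imp pfam_bex[where e = 3] pfam_sym_at
      finite_UNIV_sym card_UNIV_sym pfam_boundary pfam_bex_clause_at pfam_const)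

lemma pfam_occ_clause: "pfam (\<lambda>n x w. occ_clause w (L n x))"
proof -
  have "pfam (\<lambda>n x w. (\<exists>p<length w. boundary w p \<and> (\<exists>r\<in>chains (length w). (r \<noteq> [] \<and> L n x = occ ` set r) \<and>
       clause_at w p r)) \<or>
     (\<exists>a<length w. \<exists>a'<length w. L n x = {Neg (Suc a), Pos (Suc a')} \<and> same_num w a a'))"
    by (intro pfam_or pfam_bex_less pfam_and pfam_boundary pfam_bex_clause_at pfam_const pfam_same_num)
  then show ?thesis by (rule pfam_cong) (auto simp: occ_clause_def)
qed


section \<open>Reading a word is deterministic\<close>

lemma sym_at_unique: "sym_at w p S \<Longrightarrow> sym_at w p T \<Longrightarrow> S = T"
  unfolding sym_at_def by (auto intro: sym_bits_inj)

lemma sym_at_less: "sym_at w p S \<Longrightarrow> p < length w"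
proof -
  assume "sym_at w p S"
  then have "length (take 3 (drop (3 * p) w)) = 3" unfolding sym_at_def by simp
  then show ?thesis by simp
qed

lemma sym_bits_not_Nil [simp]: "sym_bits S \<noteq> []" "[] \<noteq> sym_bits S"
  by (cases S; simp)+

lemma sym_at_to_bits: "sym_at (to_bits s) p S \<longleftrightarrow> p < length s \<and> s ! p = S"
proof (induction p arbitrary: s)
  case 0
  show ?case
  proof (cases s)
    case (Cons x s')
    then show ?thesis by (auto simp: sym_at_def to_bits_def dest: sym_bits_inj)
  qed (simp add: sym_at_def to_bits_def)
next
  case (Suc p)
  show ?case
  proof (cases s)
    case Nil
    then show ?thesis by (simp add: sym_at_def to_bits_def)
  next
    case (Cons x s')
    have "drop (3 * Suc p) (to_bits s) = drop (3 * p) (to_bits s')"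
      using Cons by (simp add: to_bits_def)
    then have "sym_at (to_bits s) (Suc p) S = sym_at (to_bits s') p S" by (simp add: sym_at_def)
    with Suc Cons show ?thesis by simp
  qed
qed

lemma ex_to_bits:
  assumes "3 dvd length w" "\<And>p. 3 * p < length w \<Longrightarrow> \<exists>S. sym_at w p S"
  shows "\<exists>s. w = to_bits s"
  using assms
proof (induction "length w" arbitrary: w rule: less_induct)
  case less
  show ?case
  proof (cases "w = []")
    case True
    then show ?thesis by (intro exI[of _ "[]"]) (simp add: to_bits_def)
  next
    case False
    then obtain S where S: "take 3 w = sym_bits S" using less.prems(2)[of 0] by (auto simp: sym_at_def)
    have "3 \<le> length w" using False less.prems(1) by (auto dest: dvd_imp_le)
    have "\<exists>s. drop 3 w = to_bits s"
    proof (rule less.hyps)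
      show "length (drop 3 w) < length w" using False by simp
      show "3 dvd length (drop 3 w)" using less.prems(1) by simp
      fix p assume "3 * p < length (drop 3 w)"
      then have "3 * Suc p < length w" by simp
      then obtain T where "sym_at w (Suc p) T" using less.prems(2) by blast
      then show "\<exists>S. sym_at (drop 3 w) p S" by (intro exI[of _ T]) (simp add: sym_at_def add.commute)
    qed
    then obtain s where "drop 3 w = to_bits s" ..
    with S have "w = to_bits (S # s)" by (metis append_take_drop_id concat.simps(2) list.simps(9) to_bits_def)
    then show ?thesis ..
  qed
qed

text \<open>The closing separator is not a digit, so no longer numeral can run across it.\<close>

lemma num_at_unique:
  assumes "num_at w a e" "num_at w a e'"
  shows "e = e'"
proof -
  have "\<not> e < e'" if "num_at w a e" "num_at w a e'" for e e'
  proof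
    assume "e < e'"
    have "sym_at w e SSep" "a < e" using that(1) by (simp_all add: num_at_def)
    moreover have "sym_at w e S0 \<or> sym_at w e S1"
      using that(2) sym_at_less[OF \<open>sym_at w e SSep\<close>] \<open>a < e\<close> \<open>e < e'\<close> by (simp add: num_at_def)
    ultimately show False by (auto dest: sym_at_unique)
  qed
  from this[OF assms] this[OF assms(2,1)] show ?thesis by simp
qed

lemma num_at_start: "num_at w a e \<Longrightarrow> sym_at w a S1"
  by (simp add: num_at_def)

lemma clause_at_Nil_Cons: "clause_at w p [] \<Longrightarrow> \<not> clause_at w p (i # r)"
  using sym_at_unique[of w p SEnd S1] sym_at_unique[of w p SEnd SNeg] num_at_start[of w p]
  by (cases i) (auto split: if_splits)

text \<open>The symbol at the current position decides how to go on: \<open>SEnd\<close> ends the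
  clause, \<open>SNeg\<close> starts a negative literal, the leading digit \<open>S1\<close> a
  positive one. Thus a chain found at a boundary is the parse of the actual clause there.\<close>

lemma clause_at_unique: "clause_at w p r \<Longrightarrow> clause_at w p r' \<Longrightarrow> r = r'"
proof (induction r arbitrary: p r')
  case Nil
  then show ?case
    using clause_at_Nil_Cons by (cases r') blast+
next
  case (Cons i r)
  obtain g a e where i: "i = (g, a, e)" by (cases i)
  have "r' \<noteq> []"
    using Cons.prems clause_at_Nil_Cons by blast
  then obtain g' a' e' r'' where r': "r' = (g', a', e') # r''" by (cases r') auto
  have 1: "if g then a = p else a = Suc p \<and> sym_at w p SNeg" "num_at w a e" "clause_at w (Suc e) r"
    using Cons.prems(1) i by auto
  have 2: "if g' then a' = p else a' = Suc p \<and> sym_at w p SNeg" "num_at w a' e'" "clause_at w (Suc e') r''"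
    using Cons.prems(2) r' by auto
  have "g = g'" using 1(1) 2(1) num_at_start[OF 1(2)] num_at_start[OF 2(2)]
    by (cases g; cases g') (auto dest: sym_at_unique)
  moreover from this have "a = a'" using 1(1) 2(1) by (auto split: if_splits)
  moreover from this have "e = e'" using num_at_unique 1(2) 2(2) by blast
  ultimately show ?case using Cons.IH 1(3) 2(3) i r' by simp
qed

lemma num_at_less: "num_at w a e \<Longrightarrow> a < length w \<and> e < length w"
  unfolding num_at_def using sym_at_less by blast

lemma clause_at_items: "clause_at w p r \<Longrightarrow> (g, a, e) \<in> set r \<Longrightarrow> num_at w a e"
proof (induction r arbitrary: p)
  case (Cons i r)
  then show ?case by (cases i) auto
qed simp

lemma clause_at_chains:
  assumes "clause_at w p r" "length r \<le> 3"
  shows "r \<in> chains (length w)"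
  using clause_at_items[OF assms(1)] num_at_less assms(2) unfolding chains_def by fastforce

section \<open>Parses by positions and encoded formulas\<close>

definition dig :: "bool \<Rightarrow> sym" where "dig b = (if b then S1 else S0)"

definition num_bits :: "sym list \<Rightarrow> nat \<Rightarrow> nat \<Rightarrow> bool list" where
  "num_bits s a e = map (\<lambda>x. x = S1) (take (e - a) (drop a s))"

definition num_val :: "sym list \<Rightarrow> nat \<Rightarrow> nat \<Rightarrow> nat" where
  "num_val s a e = bits_val (num_bits s a e)"

lemma bin_bits_val: "xs \<noteq> [] \<Longrightarrow> hd xs \<Longrightarrow> bin (bits_val xs) = xs \<and> 0 < bits_val xs"
proof (induction xs rule: rev_induct)
  case (snoc b xs)
  show ?case
  proof (cases "xs = []")
    case True
    then show ?thesis using snoc bits_val_simps(2)[of "[]" b] by (simp add: bin_pos)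
  next
    case False
    then have "bin (bits_val xs) = xs" "0 < bits_val xs" using snoc by auto
    then show ?thesis by (subst bin_pos) auto
  qed
qed simp

lemma enc_lit_dig: "enc_lit (Pos v) = map dig (bin v)" "enc_lit (Neg v) = SNeg # map dig (bin v)"
  by (simp_all add: dig_def)

lemma num_at_bin:
  assumes "num_at (to_bits s) a e"
  shows "bin (num_val s a e) = num_bits s a e" "1 \<le> num_val s a e"
    "length (num_bits s a e) = e - a" "e < length s"
    "drop a s = map dig (num_bits s a e) @ SSep # drop (Suc e) s"
proof -
  have ae: "a < e" "e < length s" "s ! a = S1" "s ! e = SSep"
    using assms by (auto simp: num_at_def sym_at_to_bits)
  have mid: "s ! t = S0 \<or> s ! t = S1" if "a \<le> t" "t < e" for t
  proof (cases "t = a")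
    case False
    then have t: "a < t" "t < length (to_bits s)" using that ae by auto
    have "\<forall>t<length (to_bits s). a < t \<and> t < e \<longrightarrow> sym_at (to_bits s) t S0 \<or> sym_at (to_bits s) t S1"
      using assms unfolding num_at_def by simp
    from this[rule_format, OF t(2)] t(1) that(2) show ?thesis unfolding sym_at_to_bits by blast
  qed (simp add: ae)
  show len: "length (num_bits s a e) = e - a" using ae by (simp add: num_bits_def)
  have nth: "num_bits s a e ! t = (s ! (a + t) = S1)" if "t < e - a" for t
    using that ae by (simp add: num_bits_def)
  have ne: "num_bits s a e \<noteq> []" using len ae by auto
  have "hd (num_bits s a e)" using nth[of 0] ae ne by (simp add: hd_conv_nth)
  with bin_bits_val[OF ne] show "bin (num_val s a e) = num_bits s a e" "1 \<le> num_val s a e"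
    by (simp_all add: num_val_def)
  show "e < length s" by fact
  have "map dig (num_bits s a e) = take (e - a) (drop a s)"
  proof (rule nth_equalityI)
    fix t assume "t < length (map dig (num_bits s a e))"
    then have "t < e - a" using len by simp
    then show "map dig (num_bits s a e) ! t = take (e - a) (drop a s) ! t"
      using len nth mid[of "a + t"] ae by (auto simp: dig_def)
  qed (use len ae in simp)
  moreover have "drop e s = SSep # drop (Suc e) s" using Cons_nth_drop_Suc[OF ae(2)] ae(4) by simp
  moreover have "drop a s = take (e - a) (drop a s) @ drop e s"
    using append_take_drop_id[of "e - a" "drop a s"] ae(1) by simp
  ultimately show "drop a s = map dig (num_bits s a e) @ SSep # drop (Suc e) s" by simp
qed

text \<open>The converse of \<open>num_at_bin\<close>, used when a word is known to encode a
  formula: the leading digit of \<open>bin v\<close> is 1 for positive \<open>v\<close>, by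
  induction on halving.\<close>

lemma num_atI:
  assumes "drop a s = map dig (bin v) @ SSep # rest" "1 \<le> v"
  defines "e \<equiv> a + length (bin v)"
  shows "num_at (to_bits s) a e" "num_val s a e = v" "rest = drop (Suc e) s"
proof -
  have "bin v \<noteq> []" using assms(2) by (simp add: bin_pos)
  have len: "length (drop a s) = length (bin v) + 1 + length rest" using assms(1) by simp
  have nth: "s ! (a + t) = (map dig (bin v) @ SSep # rest) ! t" if "t < length (bin v) + 1" for t
  proof -
    have "drop a s ! t = s ! (a + t)" using len by (intro nth_drop) simp
    then show ?thesis using assms(1) by simp
  qed
  have hd: "hd (bin v)" if "1 \<le> v" for v
    using that
  proof (induction v rule: less_induct)
    case (less v)
    show ?case
    proof (cases "v = 1")
      case False
      then have "hd (bin (v div 2))" "bin (v div 2) \<noteq> []" using less by (auto simp: bin_pos)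
      then show ?thesis using less.prems by (simp add: bin_pos)
    qed (simp add: bin_pos)
  qed
  show "num_at (to_bits s) a e"
    unfolding num_at_def sym_at_to_bits
  proof (intro conjI allI impI)
    show "a < e" using \<open>bin v \<noteq> []\<close> by (simp add: e_def)
    show "a < length s" "e < length s" using len by (auto simp: e_def)
    show "s ! a = S1" using nth[of 0] hd[OF assms(2)] \<open>bin v \<noteq> []\<close>
      by (simp add: nth_append dig_def hd_conv_nth)
    show "s ! e = SSep" using nth[of "length (bin v)"] by (simp add: e_def nth_append)
    fix t assume t: "a < t \<and> t < e"
    then have "t < length s" using len unfolding e_def length_drop by linarith
    moreover have "t - a < length (bin v)" using t unfolding e_def by linarith
    then have "s ! t = S0 \<or> s ! t = S1"
      using nth[of "t - a"] t by (simp add: nth_append dig_def)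
    ultimately show "t < length s \<and> s ! t = S0 \<or> t < length s \<and> s ! t = S1" by blast
  qed
  have "num_bits s a e = bin v"
    unfolding num_bits_def e_def assms(1) by (simp add: o_def dig_def)
  then show "num_val s a e = v" by (simp add: num_val_def)
  have "drop (Suc e) s = drop (Suc (length (bin v))) (drop a s)" by (simp add: e_def add.commute)
  then show "rest = drop (Suc e) s" unfolding assms(1) by simp
qed

text \<open>The literal written in the word, in contrast to \<open>occ\<close>, which names the same
  occurrence by its position.\<close>

fun occ_lit :: "sym list \<Rightarrow> bool \<times> nat \<times> nat \<Rightarrow> lit" where
  "occ_lit s (g, a, e) = (if g then Pos (num_val s a e) else Neg (num_val s a e))"

text \<open>Here \<open>q\<close> is the position of the closing \<open>SEnd\<close>, so
  \<open>Suc q\<close> is the next boundary. That \<open>q\<close> is not before \<open>p\<close>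
  gives progress when a word is read clause by clause.\<close>

lemma clause_at_imp_enc_clause:
  assumes "clause_at (to_bits s) p r"
  shows "\<exists>q\<ge>p. drop p s = enc_clause (map (occ_lit s) r) @ drop (Suc q) s \<and>
    sym_at (to_bits s) q SEnd"
  using assms
proof (induction r arbitrary: p)
  case Nil
  then have "drop p s = SEnd # drop (Suc p) s"
    using Cons_nth_drop_Suc[of p s] by (auto simp: sym_at_to_bits)
  with Nil show ?case by (intro exI[of _ p]) (simp add: enc_clause_def)
next
  case (Cons i r)
  obtain g a e where i: "i = (g, a, e)" by (cases i)
  have 1: "if g then a = p else a = Suc p \<and> sym_at (to_bits s) p SNeg"
    "num_at (to_bits s) a e" "clause_at (to_bits s) (Suc e) r"
    using Cons.prems i by auto
  obtain q where q: "Suc e \<le> q" "drop (Suc e) s = enc_clause (map (occ_lit s) r) @ drop (Suc q) s"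
    "sym_at (to_bits s) q SEnd"
    using Cons.IH[OF 1(3)] by auto
  have "drop p s = enc_lit (occ_lit s i) @ SSep # drop (Suc e) s"
  proof (cases g)
    case True
    then show ?thesis using num_at_bin(1,5)[OF 1(2)] 1(1) i by (simp only: enc_lit_dig occ_lit.simps if_True)
  next
    case False
    then have "drop p s = SNeg # drop a s"
      using 1(1) Cons_nth_drop_Suc[of p s] by (auto simp: sym_at_to_bits)
    then show ?thesis using num_at_bin(1,5)[OF 1(2)] False i
      by (simp only: enc_lit_dig occ_lit.simps if_False append_Cons)
  qed
  moreover have "p \<le> q" using 1(1,2) q(1) by (auto simp: num_at_def split: if_splits)
  ultimately show ?case using q by (intro exI[of _ q]) (simp add: enc_clause_def)
qed

lemma enc_clause_imp_clause_at:
  assumes "drop p s = enc_clause c @ rest" "\<And>l. l \<in> set c \<Longrightarrow> 1 \<le> lit_var l"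
  shows "\<exists>r. clause_at (to_bits s) p r \<and> map (occ_lit s) r = c"
  using assms
proof (induction c arbitrary: p)
  case Nil
  then have d: "drop p s = SEnd # rest" by (simp add: enc_clause_def)
  then have "p < length s" using drop_all[of s p] by (cases "p < length s") auto
  with d have "s ! p = SEnd" using Cons_nth_drop_Suc[of p s] by simp
  with \<open>p < length s\<close> show ?case by (intro exI[of _ "[]"]) (simp add: sym_at_to_bits)
next
  case (Cons l c)
  have d: "drop p s = enc_lit l @ SSep # enc_clause c @ rest"
    using Cons.prems(1) by (simp add: enc_clause_def)
  have "1 \<le> lit_var l" using Cons.prems(2) by simp
  have "\<exists>g a e. (if g then a = p else a = Suc p \<and> sym_at (to_bits s) p SNeg) \<and>
      num_at (to_bits s) a e \<and> occ_lit s (g, a, e) = l \<and> enc_clause c @ rest = drop (Suc e) s"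
  proof (cases l)
    case (Pos v)
    have "drop p s = map dig (bin v) @ SSep # enc_clause c @ rest"
      using d unfolding Pos enc_lit_dig .
    from num_atI[OF this] Pos \<open>1 \<le> lit_var l\<close> show ?thesis
      by (intro exI[of _ True] exI[of _ p] exI[of _ "p + length (bin v)"]) auto
  next
    case (Neg v)
    have d': "drop p s = SNeg # map dig (bin v) @ SSep # enc_clause c @ rest"
      using d unfolding Neg enc_lit_dig by simp
    then have "p < length s" using drop_all[of s p] by (cases "p < length s") auto
    with d' have "s ! p = SNeg" "drop (Suc p) s = map dig (bin v) @ SSep # enc_clause c @ rest"
      using Cons_nth_drop_Suc[of p s] by simp_all
    from num_atI[OF this(2)] Neg \<open>1 \<le> lit_var l\<close> \<open>s ! p = SNeg\<close> \<open>p < length s\<close> show ?thesis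
      by (intro exI[of _ False] exI[of _ "Suc p"] exI[of _ "Suc p + length (bin v)"])
        (auto simp: sym_at_to_bits)
  qed
  then obtain g a e where gae: "if g then a = p else a = Suc p \<and> sym_at (to_bits s) p SNeg"
      "num_at (to_bits s) a e" "occ_lit s (g, a, e) = l" "drop (Suc e) s = enc_clause c @ rest"
    by metis
  from Cons.IH[OF gae(4)] Cons.prems(2) obtain r
    where "clause_at (to_bits s) (Suc e) r" "map (occ_lit s) r = c" by auto
  with gae show ?case by (intro exI[of _ "(g, a, e) # r"]) simp
qed


lemma SEnd_not_in_lits: "SEnd \<notin> set (concat (map (\<lambda>l. enc_lit l @ [SSep]) c))"
proof -
  have "SEnd \<notin> set (enc_lit l)" for l by (cases l) (auto split: if_splits)
  then show ?thesis by auto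
qed

text \<open>Since \<open>SEnd\<close> occurs only at the end of an encoded clause, a cut directly
  behind it falls between two clauses.\<close>

lemma clause_start:
  assumes "concat (map enc_clause \<phi>) = A @ B" "A = [] \<or> last A = SEnd" "B \<noteq> []"
  shows "\<exists>c\<in>set \<phi>. \<exists>rest. B = enc_clause c @ rest"
  using assms
proof (induction \<phi> arbitrary: A)
  case (Cons c \<phi>)
  show ?case
  proof (cases "A = []")
    case True
    then show ?thesis using Cons.prems by auto
  next
    case False
    let ?g = "concat (map (\<lambda>l. enc_lit l @ [SSep]) c)"
    have "enc_clause c @ concat (map enc_clause \<phi>) = A @ B" using Cons.prems(1) by simp
    then obtain us where us: "enc_clause c = A @ us \<and> us @ concat (map enc_clause \<phi>) = B \<or>
       enc_clause c @ us = A \<and> concat (map enc_clause \<phi>) = us @ B"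
      unfolding append_eq_append_conv2 ..
    \<comment> \<open>Were the cut strictly inside the first clause, \<open>A\<close> would be
      contained in the part before its \<open>SEnd\<close>, although \<open>A\<close> itself ends
      with \<open>SEnd\<close>.\<close>
    have "us = []" if c: "enc_clause c = A @ us"
    proof (rule ccontr)
      assume "us \<noteq> []"
      have "?g = butlast (A @ us)" unfolding c[symmetric] by (simp add: enc_clause_def)
      with \<open>us \<noteq> []\<close> have "set A \<subseteq> set ?g" by (simp add: butlast_append)
      moreover have "SEnd \<in> set A" using Cons.prems(2) False last_in_set[of A] by simp
      ultimately show False using SEnd_not_in_lits by blast
    qed
    with us have us': "A = enc_clause c @ us" "concat (map enc_clause \<phi>) = us @ B" by auto
    then have "us = [] \<or> last us = SEnd"
      using Cons.prems(2) False by (auto simp: last_append split: if_splits)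
    from Cons.IH[OF us'(2) this Cons.prems(3)] show ?thesis by auto
  qed
qed simp

lemma boundary_clause:
  assumes "s = concat (map enc_clause \<phi>)" "boundary (to_bits s) p" "p < length s"
  shows "\<exists>c\<in>set \<phi>. \<exists>rest. drop p s = enc_clause c @ rest"
proof (rule clause_start)
  show "concat (map enc_clause \<phi>) = take p s @ drop p s" using assms(1) by simp
  show "drop p s \<noteq> []" using assms(3) by simp
  show "take p s = [] \<or> last (take p s) = SEnd"
  proof (cases p)
    case (Suc q)
    then have "s ! q = SEnd" using assms(2) by (simp add: boundary_def sym_at_to_bits)
    then show ?thesis using Suc assms(3) by (simp add: take_Suc_conv_app_nth)
  qed simp
qed

text \<open>As \<open>bin\<close> recovers the digit string from its value, equality of the numbers
  is equality of the strings, which have no leading zeros.\<close>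

lemma num_val_eq_iff_same_num:
  assumes "num_at (to_bits s) a e" "num_at (to_bits s) a' e'"
  shows "num_val s a e = num_val s a' e' \<longleftrightarrow> same_num (to_bits s) a a'"
proof -
  note b = num_at_bin[OF assms(1)] and b' = num_at_bin[OF assms(2)]
  have nth: "num_bits s a e ! t = sym_at (to_bits s) (a + t) S1" if "t < e - a" for t
    using that b(4) by (auto simp: num_bits_def sym_at_to_bits)
  have nth': "num_bits s a' e' ! t = sym_at (to_bits s) (a' + t) S1" if "t < e' - a'" for t
    using that b'(4) by (auto simp: num_bits_def sym_at_to_bits)
  have "num_val s a e = num_val s a' e' \<longleftrightarrow> num_bits s a e = num_bits s a' e'"
    using b(1) b'(1) by (metis num_val_def)
  also have "\<dots> \<longleftrightarrow> e - a = e' - a' \<and>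
      (\<forall>t<e - a. sym_at (to_bits s) (a + t) S1 \<longleftrightarrow> sym_at (to_bits s) (a' + t) S1)"
    using b(3) b'(3) nth nth' by (auto simp: list_eq_iff_nth_eq)
  also have "\<dots> \<longleftrightarrow> same_num (to_bits s) a a'"
  proof
    assume "e - a = e' - a' \<and>
      (\<forall>t<e - a. sym_at (to_bits s) (a + t) S1 \<longleftrightarrow> sym_at (to_bits s) (a' + t) S1)"
    then show "same_num (to_bits s) a a'"
      unfolding same_num_def using assms num_at_less by blast
  next
    assume "same_num (to_bits s) a a'"
    then obtain d d' where d: "num_at (to_bits s) a d" "num_at (to_bits s) a' d'" "d - a = d' - a'"
      "\<forall>t<length (to_bits s). t < d - a \<longrightarrow>
        (sym_at (to_bits s) (a + t) S1 \<longleftrightarrow> sym_at (to_bits s) (a' + t) S1)"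
      unfolding same_num_def by blast
    have "d = e" "d' = e'" using num_at_unique d(1,2) assms by blast+
    moreover have "t < length (to_bits s)" if "t < e - a" for t using that b(4) by simp
    ultimately show "e - a = e' - a' \<and>
      (\<forall>t<e - a. sym_at (to_bits s) (a + t) S1 \<longleftrightarrow> sym_at (to_bits s) (a' + t) S1)"
      using d(3,4) by blast
  qed
  finally show ?thesis .
qed

text \<open>The local readings required by \<open>valid\<close> are glued together by induction on
  the length of the remaining word. The position and chain of each clause are recorded because they
  witness the corresponding instance of \<open>occ_clause\<close>.\<close>

lemma valid_parse:
  assumes "valid (to_bits s)" "boundary (to_bits s) p"
  shows "\<exists>\<phi>. drop p s = concat (map enc_clause \<phi>) \<and>
    (\<forall>c\<in>set \<phi>. \<exists>p r. p < length (to_bits s) \<and> r \<in> chains (length (to_bits s)) \<and> r \<noteq> [] \<and>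
       boundary (to_bits s) p \<and> clause_at (to_bits s) p r \<and> c = map (occ_lit s) r)"
  using assms(2)
proof (induction "length s - p" arbitrary: p rule: less_induct)
  case less
  show ?case
  proof (cases "p < length s")
    case False
    then show ?thesis by (intro exI[of _ "[]"]) simp
  next
    case True
    then have p: "p < length (to_bits s)" "3 * p < length (to_bits s)" by auto
    with assms(1) less.prems obtain r where r: "r \<in> chains (length (to_bits s))" "r \<noteq> []"
      "clause_at (to_bits s) p r"
      unfolding valid_def by blast
    obtain q where q: "p \<le> q" "drop p s = enc_clause (map (occ_lit s) r) @ drop (Suc q) s"
      "sym_at (to_bits s) q SEnd"
      using clause_at_imp_enc_clause[OF r(3)] by blast
    have "boundary (to_bits s) (Suc q)" using q(3) by (simp add: boundary_def)
    moreover have "length s - Suc q < length s - p" using q(1) True by simp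
    ultimately obtain \<phi> where \<phi>: "drop (Suc q) s = concat (map enc_clause \<phi>)"
      "\<forall>c\<in>set \<phi>. \<exists>p r. p < length (to_bits s) \<and> r \<in> chains (length (to_bits s)) \<and> r \<noteq> [] \<and>
       boundary (to_bits s) p \<and> clause_at (to_bits s) p r \<and> c = map (occ_lit s) r"
      using less.hyps by blast
    have "drop p s = concat (map enc_clause (map (occ_lit s) r # \<phi>))" using q(2) \<phi>(1) by simp
    moreover have "\<forall>c\<in>set (map (occ_lit s) r # \<phi>). \<exists>p r. p < length (to_bits s) \<and>
       r \<in> chains (length (to_bits s)) \<and> r \<noteq> [] \<and>
       boundary (to_bits s) p \<and> clause_at (to_bits s) p r \<and> c = map (occ_lit s) r"
      using \<phi>(2) p(1) r less.prems unfolding set_simps(2) ball_simps(7) by blast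
    ultimately show ?thesis by (intro exI[of _ "map (occ_lit s) r # \<phi>"] conjI)
  qed
qed

text \<open>Assignments are transferred both ways between the variables of the formula and their
  occurrences. An occurrence inherits the value of its variable, which respects all equality
  clauses; conversely, those clauses give all occurrences of a variable the same value.\<close>

lemma ThreeSAT_iff_occ_clause:
  "w \<in> ThreeSAT \<longleftrightarrow> valid w \<and> (\<exists>\<sigma>. \<forall>L. occ_clause w L \<longrightarrow> (\<exists>l\<in>L. lit_val \<sigma> l))"
proof
  assume "w \<in> ThreeSAT"
  then obtain \<phi> \<sigma> where \<phi>: "is_3cnf \<phi>" "w = enc_formula \<phi>"
    and \<sigma>: "\<forall>c\<in>set \<phi>. \<exists>l\<in>set c. lit_val \<sigma> l"
    unfolding ThreeSAT_def cnf_sat_def by auto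
  define s where "s = concat (map enc_clause \<phi>)"
  have w: "w = to_bits s" using \<phi>(2) by (simp add: s_def enc_formula_def)
  have parse: "\<exists>r. clause_at w p r \<and> map (occ_lit s) r \<in> set \<phi>"
    if p: "boundary w p" "p < length s" for p
  proof -
    obtain c rest where c: "c \<in> set \<phi>" "drop p s = enc_clause c @ rest"
      using boundary_clause[OF s_def] p unfolding w by blast
    have "1 \<le> lit_var l" if "l \<in> set c" for l using \<phi>(1) c(1) that unfolding is_3cnf_def by blast
    from enc_clause_imp_clause_at[OF c(2) this] c(1) show ?thesis unfolding w by auto
  qed
  have "valid w"
    unfolding valid_def
  proof (intro conjI allI impI)
    show "3 dvd length w" by (simp add: w)
    fix p assume "3 * p < length w"
    then show "\<exists>S\<in>UNIV. sym_at w p S" by (simp add: w sym_at_to_bits)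
  next
    fix p assume p: "3 * p < length w \<and> boundary w p"
    then obtain r where r: "clause_at w p r" "map (occ_lit s) r \<in> set \<phi>"
      using parse[of p] by (auto simp: w)
    have "1 \<le> length (map (occ_lit s) r) \<and> length (map (occ_lit s) r) \<le> 3"
      using \<phi>(1) r(2) unfolding is_3cnf_def by blast
    then show "\<exists>r\<in>chains (length w). r \<noteq> [] \<and> clause_at w p r"
      using clause_at_chains[OF r(1)] r(1) by (intro bexI[of _ r]) auto
  qed
  \<comment> \<open>The subtraction undoes the successor in \<open>occ\<close>. The end
    \<open>e\<close> is unique if it exists; where no number starts, the value is False.\<close>
  define \<tau> where "\<tau> = (\<lambda>x. \<exists>e. num_at w (x - 1) e \<and> \<sigma> (num_val s (x - 1) e))"
  have \<tau>: "\<tau> (Suc a) = \<sigma> (num_val s a e)" if ae: "num_at w a e" for a e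
  proof
    assume "\<tau> (Suc a)"
    then obtain e' where e': "num_at w a e'" "\<sigma> (num_val s a e')" unfolding \<tau>_def by auto
    with num_at_unique[OF ae e'(1)] show "\<sigma> (num_val s a e)" by simp
  qed (use ae in \<open>auto simp: \<tau>_def\<close>)
  have "\<exists>l\<in>L. lit_val \<tau> l" if "occ_clause w L" for L
    using that unfolding occ_clause_def
  proof (elim disjE exE bexE conjE)
    fix p r assume r: "L = occ ` set r" "boundary w p" "clause_at w p r"
    have "p < length s"
    proof -
      obtain q where "p \<le> q" "sym_at (to_bits s) q SEnd"
        using clause_at_imp_enc_clause r(3) unfolding w by blast
      then show ?thesis by (simp add: sym_at_to_bits)
    qed
    from parse[OF r(2) this] obtain r' where "clause_at w p r'" "map (occ_lit s) r' \<in> set \<phi>" by blast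
    then have "map (occ_lit s) r \<in> set \<phi>" using clause_at_unique r(3) by blast
    from bspec[OF \<sigma> this] obtain i where i: "i \<in> set r" "lit_val \<sigma> (occ_lit s i)" by auto
    obtain g a e where gae: "i = (g, a, e)" by (cases i)
    have "num_at w a e" using clause_at_items[OF r(3)] i(1) gae by blast
    then have "lit_val \<tau> (occ i)" using i(2) \<tau> gae by (simp split: if_splits)
    then show ?thesis using i(1) r(1) by blast
  next
    fix a a' assume a: "L = {Neg (Suc a), Pos (Suc a')}" "same_num w a a'"
    then obtain e e' where e: "num_at w a e" "num_at w a' e'" unfolding same_num_def by blast
    with a(2) have "num_val s a e = num_val s a' e'"
      using num_val_eq_iff_same_num[of s a e a' e'] unfolding w by blast
    then have "\<tau> (Suc a) = \<tau> (Suc a')" using \<tau> e by simp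
    then show ?thesis using a(1) by auto
  qed
  then have "\<forall>L. occ_clause w L \<longrightarrow> (\<exists>l\<in>L. lit_val \<tau> l)" by simp
  with \<open>valid w\<close> show "valid w \<and> (\<exists>\<sigma>. \<forall>L. occ_clause w L \<longrightarrow> (\<exists>l\<in>L. lit_val \<sigma> l))"
    by (intro conjI exI[of _ \<tau>])
next
  assume "valid w \<and> (\<exists>\<sigma>. \<forall>L. occ_clause w L \<longrightarrow> (\<exists>l\<in>L. lit_val \<sigma> l))"
  then obtain \<tau> where "valid w" and \<tau>: "\<And>L. occ_clause w L \<Longrightarrow> \<exists>l\<in>L. lit_val \<tau> l" by auto
  have "\<exists>s. w = to_bits s"
    by (rule ex_to_bits) (use \<open>valid w\<close> in \<open>auto simp: valid_def\<close>)
  then obtain s where w: "w = to_bits s" ..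
  \<comment> \<open>A variable is true if one of its occurrences is. The clause from that occurrence
    to any other one of the same variable makes the choice irrelevant.\<close>
  define \<sigma> where "\<sigma> = (\<lambda>v. \<exists>a e. num_at w a e \<and> num_val s a e = v \<and> \<tau> (Suc a))"
  have \<sigma>: "\<sigma> (num_val s a e) = \<tau> (Suc a)" if ae: "num_at w a e" for a e
  proof
    assume "\<sigma> (num_val s a e)"
    then obtain a' e' where a': "num_at w a' e'" "num_val s a' e' = num_val s a e" "\<tau> (Suc a')"
      unfolding \<sigma>_def by blast
    then have "same_num w a' a"
      using num_val_eq_iff_same_num[of s a' e' a e] ae unfolding w by blast
    then have "occ_clause w {Neg (Suc a'), Pos (Suc a)}"
      unfolding occ_clause_def using num_at_less[OF ae] num_at_less[OF a'(1)] by blast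
    from \<tau>[OF this] a'(3) show "\<tau> (Suc a)" by simp
  next
    assume "\<tau> (Suc a)"
    then show "\<sigma> (num_val s a e)" unfolding \<sigma>_def using ae by blast
  qed
  have "boundary (to_bits s) 0" by (simp add: boundary_def)
  from valid_parse[OF _ this] \<open>valid w\<close> obtain \<phi> where \<phi>: "s = concat (map enc_clause \<phi>)"
    and cl: "\<And>c. c \<in> set \<phi> \<Longrightarrow> \<exists>p r. p < length w \<and> r \<in> chains (length w) \<and> r \<noteq> [] \<and>
       boundary w p \<and> clause_at w p r \<and> c = map (occ_lit s) r"
    unfolding w by auto
  have "w = enc_formula \<phi>" using \<phi> w by (simp add: enc_formula_def)
  moreover have "is_3cnf \<phi>"
    unfolding is_3cnf_def
  proof (intro ballI)
    fix c assume "c \<in> set \<phi>"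
    from cl[OF this] obtain p r where r: "r \<in> chains (length w)" "r \<noteq> []" "clause_at w p r"
      "c = map (occ_lit s) r" by blast
    have "1 \<le> lit_var (occ_lit s i)" if "i \<in> set r" for i
    proof -
      obtain g a e where i: "i = (g, a, e)" by (cases i)
      have "num_at (to_bits s) a e" using clause_at_items[OF r(3)] that i unfolding w by blast
      from num_at_bin(2)[OF this] show ?thesis using i by simp
    qed
    moreover have "1 \<le> length r" "length r \<le> 3"
      using r(1,2) by (auto simp: chains_def Suc_le_eq)
    ultimately show "1 \<le> length c \<and> length c \<le> 3 \<and> (\<forall>l\<in>set c. 1 \<le> lit_var l)"
      using r(4) by auto
  qed
  moreover have "cnf_sat \<phi>"
    unfolding cnf_sat_def
  proof (intro exI ballI)
    fix c assume "c \<in> set \<phi>"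
    from cl[OF this] obtain p r where r: "p < length w" "r \<in> chains (length w)" "r \<noteq> []"
      "boundary w p" "clause_at w p r" "c = map (occ_lit s) r" by blast
    then have "occ_clause w (occ ` set r)" unfolding occ_clause_def by blast
    from \<tau>[OF this] obtain i where i: "i \<in> set r" "lit_val \<tau> (occ i)" by blast
    obtain g a e where gae: "i = (g, a, e)" by (cases i)
    have "num_at w a e" using clause_at_items[OF r(5)] i(1) gae by blast
    then have "lit_val \<sigma> (occ_lit s i)" using i(2) \<sigma> gae by (simp split: if_splits)
    then show "\<exists>l\<in>set c. lit_val \<sigma> l" using i(1) r(6) by auto
  qed
  ultimately show "w \<in> ThreeSAT" unfolding ThreeSAT_def by blast
qed

text \<open>Occurrence variables are positions plus one, hence at most the length of the word. So
  every clause of the reduced formula has an index under the bijection for that number of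
  variables.\<close>

lemma occ_clause_in_Lk:
  assumes "occ_clause w L"
  shows "L \<in> Lk (length w)"
  using assms unfolding occ_clause_def
proof (elim disjE exE bexE conjE)
  fix p r assume r: "r \<in> chains (length w)" "r \<noteq> []" "L = occ ` set r"
  have "occ i \<in> lits (length w)" if "i \<in> set r" for i
  proof -
    have "i \<in> UNIV \<times> {..<length w} \<times> {..<length w}" using that r(1) unfolding chains_def by blast
    then show ?thesis by (cases i) (auto simp: lits_def Suc_le_eq)
  qed
  moreover have "card (occ ` set r) \<le> length r"
    by (rule le_trans[OF card_image_le card_length]) simp
  moreover have "0 < card (occ ` set r)" using r(2) by (simp add: card_gt_0_iff)
  moreover have "length r \<le> 3" using r(1) by (simp add: chains_def)
  ultimately show ?thesis unfolding r(3) Lk_def mem_Collect_eq Suc_le_eq One_nat_def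
    by (intro conjI image_subsetI) auto
next
  fix a a' assume "a < length w" "a' < length w" "L = {Neg (Suc a), Pos (Suc a')}"
  then show ?thesis by (simp add: Lk_def lits_def Suc_le_eq)
qed

lemma ThreeSATC_imp_ThreeSAT:
  assumes bij: "\<And>k. bij_betw (\<alpha> k) {1..dd k} (Lk k)"
    and satc: "pfam (\<lambda>n (_ :: unit). ThreeSATC \<alpha> n)"
  shows "pfam (\<lambda>n (_ :: unit) w. w \<in> ThreeSAT)"
proof -
  \<comment> \<open>The new instance has one bit for each clause over n variables, telling whether
    the clause belongs to the formula built from \<open>w\<close>; the shift by one is due to lists
    being indexed from 0.\<close>
  have "pfam (\<lambda>n (_ :: unit) w.
      ThreeSATC \<alpha> (dd n) (map (\<lambda>i. occ_clause w (\<alpha> n (Suc i))) [0..<dd n]))"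
    by (rule pfam_compose[OF satc pfam_occ_clause dd_le_power])
  then have "pfam (\<lambda>n (_ :: unit) w. valid w \<and>
      ThreeSATC \<alpha> (dd n) (map (\<lambda>i. occ_clause w (\<alpha> n (Suc i))) [0..<dd n]))"
    by (intro pfam_and pfam_valid)
  then show ?thesis
  proof (rule pfam_cong, goal_cases)
    case (1 n u w)
    have nth: "map (\<lambda>i. occ_clause w (\<alpha> n (Suc i))) [0..<dd n] ! (i - 1) = occ_clause w (\<alpha> n i)"
      if "i \<in> {1..dd n}" for i
      using that by (cases i) auto
    have "ThreeSATC \<alpha> (dd n) (map (\<lambda>i. occ_clause w (\<alpha> n (Suc i))) [0..<dd n]) \<longleftrightarrow>
        (\<exists>\<sigma>. \<forall>i\<in>{1..dd n}. occ_clause w (\<alpha> n i) \<longrightarrow> (\<exists>l\<in>\<alpha> n i. lit_val \<sigma> l))"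
      unfolding ThreeSATC_def kk_dd
      by (rule arg_cong[where f = Ex], rule HOL.ext, rule ball_cong[OF refl]) (simp only: nth)
    \<comment> \<open>Surjectivity of the bijection turns the quantifier over indices into one over
      all clauses in \<open>Lk n\<close>, and no clause of the reduced formula lies outside this
      set.\<close>
    also have "\<dots> \<longleftrightarrow> (\<exists>\<sigma>. \<forall>L\<in>Lk n. occ_clause w L \<longrightarrow> (\<exists>l\<in>L. lit_val \<sigma> l))"
      using bij_betw_imp_surj_on[OF bij, of n, symmetric] by simp
    also have "\<dots> \<longleftrightarrow> (\<exists>\<sigma>. \<forall>L. occ_clause w L \<longrightarrow> (\<exists>l\<in>L. lit_val \<sigma> l))"
      using occ_clause_in_Lk 1 by blast
    finally show ?case by (simp only: ThreeSAT_iff_occ_clause)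
  qed
qed

theorem theorem8:
  fixes \<alpha> :: "nat \<Rightarrow> nat \<Rightarrow> lit set"
  assumes "alpha_family \<alpha>"
  shows "ThreeSATC \<alpha> \<notin> P_lis \<longleftrightarrow> ThreeSAT \<notin> P_poly"
proof -
  have bij: "\<And>k. bij_betw (\<alpha> k) {1..dd k} (Lk k)"
    using assms by (simp add: alpha_family_def)
  show ?thesis
    unfolding P_lis_iff_pfam P_poly_iff_pfam
    using ThreeSAT_imp_ThreeSATC[OF bij] ThreeSATC_imp_ThreeSAT[OF bij] by blast
qed

end
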